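(* Consider the delay-coupled Stuart–Landau oscillators with $\delta=0$, $$\dot z_1=(\alpha+i\beta)z_1+\gamma|z_1|^2z_1+\varepsilon e^{i\rho}(z_2(t-\tau)-z_1),\qquad \dot z_2=(\alpha+i\beta)z_2+\gamma|z_2|^2z_2+\varepsilon e^{i\rho}(z_1(t-\tau)-z_2),$$ whose uncoupled oscillators have periodic orbits $\Gamma_j(t)=Re^{i\Omega t}$, $R=\sqrt{-\alpha/\gamma}$, $\Omega=\beta$. The second-order phase reduced dynamics $\dot\phi=f^{(0)}(\phi)+\varepsilon f^{(1)}(\phi)+\varepsilon^2f^{(2)}(\phi)$ (defined in the context) gives, for $\psi:=\phi_1-\phi_2$, $$\dot\psi=-2\varepsilon\cos(\rho-\Omega\tau)\sin(\psi)+\varepsilon^2\Big(2\tau\sin(\rho)\sin(\rho-\Omega\tau)\sin(\psi)-\Big[\tau+\frac1\alpha\sin^2(\rho-\Omega\tau)\Big]\sin(2\psi)\Big).$$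
   Context: Parameters: $\alpha,\beta,\gamma\in\mathbb R$ with $\alpha\gamma<0$ and $\beta\ne0$, $\varepsilon\ge0$ small, $\rho\in[0,2\pi]$, $\tau>0$; $\mathbb C$ is identified with $\mathbb R^2$ and $\mathbb T^2=(\mathbb R/2\pi\mathbb Z)^2$. Phase reduction. Let $F(z)=\big((\alpha+i\beta)z_j+\gamma|z_j|^2z_j\big)_{j=1,2}$ and, for $Z\in C([-\tau,0],\mathbb C^2)$, $G(Z)=\big(e^{i\rho}[Z_2(-\tau)-Z_1(0)],\,e^{i\rho}[Z_1(-\tau)-Z_2(0)]\big)$. Put $$f^{(0)}\equiv\omega:=(\Omega,\Omega),\quad e^{(0)}(\phi)=(Re^{i\phi_1},Re^{i\phi_2}),\quad E^{(0)}(\phi,s)=(Re^{i(\phi_1+\Omega s)},Re^{i(\phi_2+\Omega s)}).$$ Let $T(\phi)=\partial_\phi e^{(0)}(\phi):\mathbb R^2\to\mathbb C^2$, i.e. $T(\phi)u=(iRe^{i\phi_1}u_1,iRe^{i\phi_2}u_2)$; $N(\phi):\mathbb R^2\to\mathbb C^2$, $N(\phi)u=(\gamma e^{i\phi_1}u_1,\gamma e^{i\phi_2}u_2)$; $L=-2\alpha I\in\mathbb R^{2\times2}$; and let $\pi(\phi)$ be the real-linear projection of $\mathbb C^2$ onto $\operatorname{im}T(\phi)$ along $\operatorname{im}N(\phi)$. Write $\partial_\omega:=\partial_\phi\cdot\omega$. For $\ell=1,2$ the functions $g^{(\ell)},f^{(\ell)}:\mathbb T^2\to\mathbb R^2$ are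 the solution of $$T(\phi)[\partial_\omega g^{(\ell)}(\phi)+f^{(\ell)}(\phi)]=\pi(\phi)\eta^{(\ell)}(\phi)$$ for which $f^{(\ell)}$ is in normal form, i.e. the Fourier coefficients $\hat f^{(\ell)}_{\mathbf k}$ vanish whenever $\langle\mathbf k,\omega\rangle=\Omega(k_1+k_2)\ne0$, and $\hat g^{(\ell)}_{\mathbf k}=0$ whenever $\langle\mathbf k,\omega\rangle=0$. Here $\eta^{(1)}(\phi)=G(E^{(0)}(\phi,\cdot))$ and $$\eta^{(2)}(\phi)=\tfrac12F''(e^{(0)}(\phi))[e^{(1)}(\phi),e^{(1)}(\phi)]-\partial_\phi e^{(1)}(\phi)\cdot f^{(1)}(\phi)+G'(E^{(0)}(\phi,\cdot))E^{(1)}(\phi,\cdot),$$ where $e^{(1)}=Tg^{(1)}+Nh^{(1)}$, $h^{(1)}:\mathbb T^2\to\mathbb R^2$ is the solution of $N(\phi)[\partial_\omega h^{(1)}-Lh^{(1)}]=(I-\pi(\phi))\eta^{(1)}(\phi)$, and $$E^{(1)}(\phi,s)=e^{(1)}(\phi+s\omega)+\partial_\phi E^{(0)}(\phi,s)\cdot\int_0^sf^{(1)}(\phi+\omega(s-\zeta))\,d\zeta.$$ *)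

theory Defs
  imports "HOL-Analysis.Analysis"
begin

(* Functions on the torus (R/2 pi Z)^2 are represented by doubly 2 pi-periodic functions on R^2. *)

definition torus_fun :: "(real \<times> real \<Rightarrow> 'a) \<Rightarrow> bool" where
  "torus_fun u \<longleftrightarrow> (\<forall>x y. u (x + 2 * pi, y) = u (x, y) \<and> u (x, y + 2 * pi) = u (x, y))"

definition C0_torus :: "(real \<times> real \<Rightarrow> 'a::real_normed_vector) \<Rightarrow> bool" where
  "C0_torus u \<longleftrightarrow> torus_fun u \<and> continuous_on UNIV u"

definition C1_torus :: "(real \<times> real \<Rightarrow> 'a::real_normed_vector) \<Rightarrow> bool" where
  "C1_torus u \<longleftrightarrow> torus_fun u \<and> (\<forall>\<phi>. u differentiable (at \<phi>)) \<and>
     (\<forall>v. continuous_on UNIV (\<lambda>\<phi>. frechet_derivative u (at \<phi>) v))"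

definition fourier_coeff :: "(real \<times> real \<Rightarrow> real) \<Rightarrow> int \<times> int \<Rightarrow> complex" where
  "fourier_coeff u k =
     integral (cbox (0, 0) (2 * pi, 2 * pi))
       (\<lambda>\<phi>. complex_of_real (u \<phi>) * cis (- (of_int (fst k) * fst \<phi> + of_int (snd k) * snd \<phi>)))
     / complex_of_real ((2 * pi)\<^sup>2)"

definition fourier_coeff2 :: "(real \<times> real \<Rightarrow> real \<times> real) \<Rightarrow> int \<times> int \<Rightarrow> complex \<times> complex" where
  "fourier_coeff2 u k = (fourier_coeff (\<lambda>\<phi>. fst (u \<phi>)) k, fourier_coeff (\<lambda>\<phi>. snd (u \<phi>)) k)"

(* No condition on the parameters is imposed here: the constants below are total functions of the
   parameters, and all hypotheses appear in the theorem. *)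

locale stuart_landau =
  fixes \<alpha> \<beta> \<gamma> \<rho> \<tau> :: real
begin

definition sl :: "complex \<Rightarrow> complex" where
  "sl z = Complex \<alpha> \<beta> * z + complex_of_real (\<gamma> * (cmod z)\<^sup>2) * z"

definition F :: "complex \<times> complex \<Rightarrow> complex \<times> complex" where
  "F z = (sl (fst z), sl (snd z))"

(* C([-tau,0], C^2) with the sup norm is identified isometrically with the bounded continuous
   functions on the real line that are constant to the left of -tau and to the right of 0;
   segment Z is the element that represents the restriction of Z to [-tau,0]. *)

definition segment :: "(real \<Rightarrow> complex \<times> complex) \<Rightarrow> (real \<Rightarrow>\<^sub>C (complex \<times> complex))" where
  "segment Z = Bcontfun (ext_cont Z (- \<tau>) 0)"

definition G :: "(real \<Rightarrow>\<^sub>C (complex \<times> complex)) \<Rightarrow> complex \<times> complex" where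
  "G Z = (cis \<rho> * (snd (apply_bcontfun Z (- \<tau>)) - fst (apply_bcontfun Z 0)),
          cis \<rho> * (fst (apply_bcontfun Z (- \<tau>)) - snd (apply_bcontfun Z 0)))"

definition R :: real where
  "R = sqrt (- \<alpha> / \<gamma>)"

definition \<Omega> :: real where
  "\<Omega> = \<beta>"

definition \<omega> :: "real \<times> real" where
  "\<omega> = (\<Omega>, \<Omega>)"

definition \<Gamma> :: "real \<Rightarrow> complex" where
  "\<Gamma> t = complex_of_real R * cis (\<Omega> * t)"

definition f0 :: "real \<times> real \<Rightarrow> real \<times> real" where
  "f0 \<phi> = \<omega>"

definition e0 :: "real \<times> real \<Rightarrow> complex \<times> complex" where
  "e0 \<phi> = (complex_of_real R * cis (fst \<phi>), complex_of_real R * cis (snd \<phi>))"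

definition E0 :: "real \<times> real \<Rightarrow> real \<Rightarrow> complex \<times> complex" where
  "E0 \<phi> s = (complex_of_real R * cis (fst \<phi> + \<Omega> * s), complex_of_real R * cis (snd \<phi> + \<Omega> * s))"

definition T :: "real \<times> real \<Rightarrow> real \<times> real \<Rightarrow> complex \<times> complex" where
  "T \<phi> = frechet_derivative e0 (at \<phi>)"

definition N :: "real \<times> real \<Rightarrow> real \<times> real \<Rightarrow> complex \<times> complex" where
  "N \<phi> u = (complex_of_real \<gamma> * cis (fst \<phi>) * complex_of_real (fst u),
            complex_of_real \<gamma> * cis (snd \<phi>) * complex_of_real (snd u))"

definition L :: "real \<times> real \<Rightarrow> real \<times> real" where
  "L u = (- 2 * \<alpha>) *\<^sub>R u"

definition proj :: "real \<times> real \<Rightarrow> complex \<times> complex \<Rightarrow> complex \<times> complex" where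
  "proj \<phi> v = (THE w. w \<in> range (T \<phi>) \<and> v - w \<in> range (N \<phi>))"

definition D\<omega> :: "(real \<times> real \<Rightarrow> 'a::real_normed_vector) \<Rightarrow> real \<times> real \<Rightarrow> 'a" where
  "D\<omega> u \<phi> = frechet_derivative u (at \<phi>) \<omega>"

definition resonant :: "int \<times> int \<Rightarrow> bool" where
  "resonant k \<longleftrightarrow> of_int (fst k) * fst \<omega> + of_int (snd k) * snd \<omega> = 0"

(* Solutions are sought among C^1 functions g, h and continuous functions f on the torus, the least
   regularity for which the equations and the Fourier conditions make sense classically. *)

definition tangential_solution ::
  "(real \<times> real \<Rightarrow> complex \<times> complex) \<Rightarrow>
   (real \<times> real \<Rightarrow> real \<times> real) \<times> (real \<times> real \<Rightarrow> real \<times> real) \<Rightarrow> bool" where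
  "tangential_solution \<eta> = (\<lambda>(g, f).
     C1_torus g \<and> C0_torus f \<and>
     (\<forall>\<phi>. T \<phi> (D\<omega> g \<phi> + f \<phi>) = proj \<phi> (\<eta> \<phi>)) \<and>
     (\<forall>k. \<not> resonant k \<longrightarrow> fourier_coeff2 f k = 0) \<and>
     (\<forall>k. resonant k \<longrightarrow> fourier_coeff2 g k = 0))"

definition normal_solution ::
  "(real \<times> real \<Rightarrow> complex \<times> complex) \<Rightarrow> (real \<times> real \<Rightarrow> real \<times> real) \<Rightarrow> bool" where
  "normal_solution \<eta> h \<longleftrightarrow>
     C1_torus h \<and> (\<forall>\<phi>. N \<phi> (D\<omega> h \<phi> - L (h \<phi>)) = \<eta> \<phi> - proj \<phi> (\<eta> \<phi>))"

definition \<eta>1 :: "real \<times> real \<Rightarrow> complex \<times> complex" where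
  "\<eta>1 \<phi> = G (segment (E0 \<phi>))"

definition g1 :: "real \<times> real \<Rightarrow> real \<times> real" where
  "g1 = fst (THE p. tangential_solution \<eta>1 p)"

definition f1 :: "real \<times> real \<Rightarrow> real \<times> real" where
  "f1 = snd (THE p. tangential_solution \<eta>1 p)"

definition h1 :: "real \<times> real \<Rightarrow> real \<times> real" where
  "h1 = (THE h. normal_solution \<eta>1 h)"

definition e1 :: "real \<times> real \<Rightarrow> complex \<times> complex" where
  "e1 \<phi> = T \<phi> (g1 \<phi>) + N \<phi> (h1 \<phi>)"

(* The interval integral LBINT is oriented, as needed for s < 0. *)

definition E1 :: "real \<times> real \<Rightarrow> real \<Rightarrow> complex \<times> complex" where
  "E1 \<phi> s = e1 (\<phi> + s *\<^sub>R \<omega>) +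
     frechet_derivative (\<lambda>\<theta>. E0 \<theta> s) (at \<phi>) (LBINT \<zeta>=0..s. f1 (\<phi> + (s - \<zeta>) *\<^sub>R \<omega>))"

definition F'' :: "complex \<times> complex \<Rightarrow> complex \<times> complex \<Rightarrow> complex \<times> complex \<Rightarrow> complex \<times> complex" where
  "F'' z v w = frechet_derivative (\<lambda>x. frechet_derivative F (at x) v) (at z) w"

definition \<eta>2 :: "real \<times> real \<Rightarrow> complex \<times> complex" where
  "\<eta>2 \<phi> = (1 / 2) *\<^sub>R F'' (e0 \<phi>) (e1 \<phi>) (e1 \<phi>)
         - frechet_derivative e1 (at \<phi>) (f1 \<phi>)
         + frechet_derivative G (at (segment (E0 \<phi>))) (segment (E1 \<phi>))"

definition f2 :: "real \<times> real \<Rightarrow> real \<times> real" where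
  "f2 = snd (THE p. tangential_solution \<eta>2 p)"

definition reduced_field :: "real \<Rightarrow> real \<times> real \<Rightarrow> real \<times> real" where
  "reduced_field \<epsilon> \<phi> = f0 \<phi> + \<epsilon> *\<^sub>R f1 \<phi> + \<epsilon>\<^sup>2 *\<^sub>R f2 \<phi>"

lemma T_eq:
  "T \<phi> u = (\<i> * complex_of_real R * cis (fst \<phi>) * complex_of_real (fst u),
            \<i> * complex_of_real R * cis (snd \<phi>) * complex_of_real (snd u))"
proof -
  have "(e0 has_derivative
     (\<lambda>u. (\<i> * complex_of_real R * cis (fst \<phi>) * complex_of_real (fst u),
            \<i> * complex_of_real R * cis (snd \<phi>) * complex_of_real (snd u)))) (at \<phi>)"
    unfolding e0_def
    by (auto intro!: derivative_eq_intros simp: algebra_simps fun_eq_iff scaleR_conv_of_real)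
  from frechet_derivative_at[OF this] show ?thesis
    by (simp add: T_def fun_eq_iff)
qed

lemma apply_segment:
  assumes "continuous_on {- \<tau>..0} Z" and "s \<in> {- \<tau>..0}"
  shows "apply_bcontfun (segment Z) s = Z s"
proof -
  have "ext_cont Z (- \<tau>) 0 \<in> bcontfun"
    using assms clamp_continuous_on[of "- \<tau>" 0 Z UNIV]
    by (auto simp: bcontfun_def ext_cont_def[abs_def]
        intro!: clamp_bounded compact_imp_bounded[OF compact_continuous_image])
  then show ?thesis
    using assms by (simp add: segment_def Bcontfun_inverse)
qed

(* The delay-coupled system is z'(t) = F (z t) + epsilon G(z_t), where z_t(s) = z (t + s). *)

lemma delay_coupled_rhs:
  fixes z :: "real \<Rightarrow> complex \<times> complex"
  assumes "\<tau> > 0" and "continuous_on {t - \<tau>..t} z"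
  shows "F (z t) + \<epsilon> *\<^sub>R G (segment (\<lambda>s. z (t + s))) =
    (Complex \<alpha> \<beta> * fst (z t) + complex_of_real (\<gamma> * (cmod (fst (z t)))\<^sup>2) * fst (z t)
       + complex_of_real \<epsilon> * cis \<rho> * (snd (z (t - \<tau>)) - fst (z t)),
     Complex \<alpha> \<beta> * snd (z t) + complex_of_real (\<gamma> * (cmod (snd (z t)))\<^sup>2) * snd (z t)
       + complex_of_real \<epsilon> * cis \<rho> * (fst (z (t - \<tau>)) - snd (z t)))"
proof -
  have "continuous_on {- \<tau>..0} (\<lambda>s. z (t + s))"
    by (rule continuous_on_compose2[OF assms(2)]) (auto intro!: continuous_intros)
  with assms(1) show ?thesis
    by (simp add: F_def sl_def G_def apply_segment scaleR_conv_of_real)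
qed

end

end

theory Submission
  imports Defs
begin

text \<open>
  Write \<open>\<psi> = \<phi>\<^sub>1 - \<phi>\<^sub>2\<close>. In the rotating frame \<open>(cis \<phi>\<^sub>1, cis \<phi>\<^sub>2)\<close> tangential and normal parts of a
  vector are the imaginary and real parts of its coordinates, and in this frame both \<open>\<eta>1\<close> and
  \<open>\<eta>2\<close> depend on \<open>\<psi>\<close> alone. A function of \<open>\<psi>\<close> is constant along \<open>\<omega>\<close>, so it has only resonant
  Fourier modes: the normal form condition puts the whole tangential right-hand side into \<open>f\<close> and
  leaves \<open>g = 0\<close>, while \<open>h\<close> is the normal right-hand side divided by \<open>2 * \<alpha>\<close>. What remains is
  trigonometry. That these are the solutions selected by the definite descriptions
  follows because \<open>D\<omega>\<close> multiplies the coefficient with index \<open>k\<close> by \<open>\<i> * (k \<bullet> \<omega>)\<close> and a continuous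
  function on the torus with vanishing Fourier coefficients vanishes.
\<close>

subsection \<open>Fourier coefficients on the torus\<close>

abbreviation torus_box :: "(real \<times> real) set" where
  "torus_box \<equiv> cbox (0, 0) (2 * pi, 2 * pi)"

text \<open>Angles with the same \<open>cis\<close> differ by an integer multiple of 2 pi, so
  periodicity lets a point of the torus be named by its pair of unit complex numbers. This serves
  both the factorisation through the circles and the transfer of points into
  \<open>torus_box\<close>.\<close>

lemma torus_fun_cong:
  assumes u: "torus_fun u" and x: "cis x = cis x'" and y: "cis y = cis y'"
  shows "u (x, y) = u (x', y')"
proof -
  have shift: "f (t + 2 * pi * of_int n) = f t"
    if f: "\<And>t. f (t + 2 * pi) = f t" for f :: "real \<Rightarrow> 'a" and t n
  proof -
    have nat: "f (t + 2 * pi * of_nat n) = f t" for t n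
    proof (induction n)
      case (Suc n)
      have "f (t + 2 * pi * of_nat (Suc n)) = f (t + 2 * pi * of_nat n + 2 * pi)"
        by (simp add: algebra_simps)
      with Suc f show ?case by simp
    qed simp
    show ?thesis
      \<comment> \<open>For negative \<open>n\<close> the natural-number shift starts at the shifted
        point and leads back to \<open>t\<close>.\<close>
      using nat[of t "nat n"] nat[of "t + 2 * pi * of_int n" "nat (- n)"]
      by (cases "n \<ge> 0") auto
  qed
  have "\<exists>n::int. t = s + 2 * pi * of_int n" if "cis t = cis s" for s t
    using that sin_cos_eq_iff[of t s] by (auto simp: complex_eq_iff)
  then obtain m n :: int where "x = x' + 2 * pi * of_int m" "y = y' + 2 * pi * of_int n"
    using x y by meson
  moreover have "u (x' + 2 * pi * of_int m, y' + 2 * pi * of_int n)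
      = u (x', y' + 2 * pi * of_int n)"
    using u shift[of "\<lambda>t. u (t, y' + 2 * pi * of_int n)"] by (simp add: torus_fun_def)
  moreover have "\<dots> = u (x', y')"
    using u shift[of "\<lambda>t. u (x', t)"] by (simp add: torus_fun_def)
  ultimately show ?thesis by simp
qed

lemma cis_Arg_mod_2pi:
  obtains t' where "t' \<in> {0..2 * pi}" "cis t' = cis t"
proof
  show "Arg2pi (cis t) \<in> {0..2 * pi}"
    using Arg2pi[of "cis t"] by simp
  show "cis (Arg2pi (cis t)) = cis t"
    using Arg2pi_eq[of "cis t"] by (simp add: cis_conv_exp)
qed

text \<open>Carries \<open>u\<close> to a compact subset of C^2, where Stone-Weierstrass applies.
  \<open>Arg\<close> jumps, so continuity of \<open>U\<close> cannot be read off its formula. It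
  holds because \<open>P\<close> maps the compact box onto the product of circles and is therefore a
  closed map, so that continuity of \<open>u\<close>, which is \<open>U\<close> after
  \<open>P\<close>, passes to \<open>U\<close>.\<close>

lemma continuous_torus_factor:
  fixes u :: "real \<times> real \<Rightarrow> 'a::real_normed_vector"
  assumes "C0_torus u"
  obtains U where "continuous_on (sphere 0 1 \<times> sphere 0 1) U"
    "\<And>x y. U (cis x, cis y) = u (x, y)"
proof
  define P :: "real \<times> real \<Rightarrow> complex \<times> complex" where "P = (\<lambda>\<phi>. (cis (fst \<phi>), cis (snd \<phi>)))"
  define U where "U = (\<lambda>z::complex \<times> complex. u (Arg (fst z), Arg (snd z)))"
  let ?S = "sphere 0 1 \<times> sphere 0 1 :: (complex \<times> complex) set"
  have tu: "torus_fun u" and cu: "continuous_on UNIV u"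
    using assms by (auto simp: C0_torus_def)
  show U: "U (cis x, cis y) = u (x, y)" for x y
    unfolding U_def by (auto intro!: torus_fun_cong[OF tu] simp: cis_Arg)
  have cP: "continuous_on torus_box P"
    unfolding P_def by (intro continuous_intros)
  have P: "P ` torus_box = ?S"
  proof (intro equalityI subsetI)
    fix z assume "z \<in> ?S"
    then have "norm (fst z) = 1" "norm (snd z) = 1" by auto
    moreover have "cis (Arg w) = w" if "norm w = 1" for w
      using that by (subst cis_Arg) (auto simp: sgn_div_norm)
    ultimately have z: "z = (cis (Arg (fst z)), cis (Arg (snd z)))" by simp
    obtain s where s: "s \<in> {0..2*pi}" "cis s = cis (Arg (fst z))" by (rule cis_Arg_mod_2pi)
    obtain t where t: "t \<in> {0..2*pi}" "cis t = cis (Arg (snd z))" by (rule cis_Arg_mod_2pi)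
    have "z = P (s, t)" using z s t by (simp add: P_def)
    with s t show "z \<in> P ` torus_box" by (auto simp: cbox_Pair_eq)
  qed (auto simp: P_def)
  have UP: "U (P \<phi>) = u \<phi>" for \<phi>
    by (simp add: P_def U)
  show "continuous_on ?S U"
    unfolding continuous_on_closed
  proof (intro allI impI)
    fix B assume "closedin (top_of_set (U ` ?S)) B"
    then obtain C where C: "closed C" "B = U ` ?S \<inter> C"
      by (auto simp: closedin_closed)
    have "closed (torus_box \<inter> u -` C)"
      by (intro continuous_closed_preimage continuous_on_subset[OF cu] C closed_cbox) auto
    then have "compact (torus_box \<inter> u -` C)"
      by (metis compact_Int_closed compact_cbox Int_assoc Int_absorb)
    then have "closed (P ` (torus_box \<inter> u -` C))"
      by (intro compact_imp_closed compact_continuous_image continuous_on_subset[OF cP]) auto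
    moreover have "?S \<inter> U -` B = P ` (torus_box \<inter> u -` C)"
    proof -
      have "?S \<inter> U -` B = P ` torus_box \<inter> U -` C" using C P by auto
      also have "\<dots> = P ` (torus_box \<inter> u -` C)" using UP by auto
      finally show ?thesis .
    qed
    ultimately show "closedin (top_of_set ?S) (?S \<inter> U -` B)"
      by (metis closed_subset inf_le1)
  qed
qed

section \<open>Trigonometric polynomials and completeness of the characters\<close>

inductive trig_polynomial :: "(real \<times> real \<Rightarrow> complex) \<Rightarrow> bool" where
  monomial: "trig_polynomial (\<lambda>\<phi>. c * cis (of_int m * fst \<phi> + of_int n * snd \<phi>))"
| add: "trig_polynomial p \<Longrightarrow> trig_polynomial q \<Longrightarrow> trig_polynomial (\<lambda>\<phi>. p \<phi> + q \<phi>)"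

lemma trig_polynomial_const: "trig_polynomial (\<lambda>_. c)"
  using trig_polynomial.monomial[of c 0 0] by simp

lemma trig_polynomial_mult:
  assumes "trig_polynomial p" "trig_polynomial q"
  shows "trig_polynomial (\<lambda>\<phi>. p \<phi> * q \<phi>)"
  using assms
proof (induction arbitrary: q rule: trig_polynomial.induct)
  case (monomial c m n)
  from monomial show ?case
  proof (induction rule: trig_polynomial.induct)
    case (monomial c' m' n')
    show ?case
      using trig_polynomial.monomial[of "c * c'" "m + m'" "n + n'"]
      by (simp add: algebra_simps cis_mult)
  next
    case (add p q)
    from trig_polynomial.add[OF add.IH] show ?case by (simp add: algebra_simps)
  qed
next
  case (add p p')
  from trig_polynomial.add[OF add.IH(1)[OF add.prems] add.IH(2)[OF add.prems]]
  show ?case by (simp add: algebra_simps)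
qed

lemma trig_polynomial_continuous:
  "trig_polynomial p \<Longrightarrow> continuous_on A p"
  by (induction rule: trig_polynomial.induct) (auto intro!: continuous_intros)

text \<open>The link between Stone-Weierstrass, which supplies polynomials in the real coordinates
  of C^2, and Fourier coefficients: on the product of circles these coordinates are sines and
  cosines, each a combination of two characters, and products of characters are characters.\<close>

lemma trig_polynomial_real_polynomial_function:
  assumes "real_polynomial_function p"
  shows "trig_polynomial (\<lambda>\<phi>. complex_of_real (p (cis (fst \<phi>), cis (snd \<phi>))))"
  using assms
proof (induction rule: real_polynomial_function.induct)
  case (linear f)
  interpret bounded_linear f by fact
  \<comment> \<open>A real-linear functional on C^2 is fixed by its values on four real basis
    vectors.\<close>
  have *: "f (z, w) = f (1, 0) * Re z + f (\<i>, 0) * Im z + f (0, 1) * Re w + f (0, \<i>) * Im w" for z w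
  proof -
    have "(z, w) = Re z *\<^sub>R (1, 0) + Im z *\<^sub>R (\<i>, 0) + Re w *\<^sub>R (0, 1) + Im w *\<^sub>R (0, \<i>)"
      by (auto simp: complex_eq_iff)
    then show ?thesis by (simp only: add scaleR) simp
  qed
  have cis_eq: "complex_of_real (cos t) = (1/2) * cis t + (1/2) * cis (- t)"
       "complex_of_real (sin t) = (-\<i>/2) * cis t + (\<i>/2) * cis (- t)" for t
    by (auto simp: complex_eq_iff)
  have cos1: "trig_polynomial (\<lambda>\<phi>. complex_of_real (cos (fst \<phi>)))"
    and sin1: "trig_polynomial (\<lambda>\<phi>. complex_of_real (sin (fst \<phi>)))"
    and cos2: "trig_polynomial (\<lambda>\<phi>. complex_of_real (cos (snd \<phi>)))"
    and sin2: "trig_polynomial (\<lambda>\<phi>. complex_of_real (sin (snd \<phi>)))"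
    using trig_polynomial.add[OF monomial[of "1/2" 1 0] monomial[of "1/2" "-1" 0]]
      trig_polynomial.add[OF monomial[of "-\<i>/2" 1 0] monomial[of "\<i>/2" "-1" 0]]
      trig_polynomial.add[OF monomial[of "1/2" 0 1] monomial[of "1/2" 0 "-1"]]
      trig_polynomial.add[OF monomial[of "-\<i>/2" 0 1] monomial[of "\<i>/2" 0 "-1"]]
    by (simp_all add: cis_eq)
  show ?case
    unfolding *[of "cis _"] of_real_add of_real_mult cis.sel
    by (intro trig_polynomial.add trig_polynomial_mult trig_polynomial_const cos1 sin1 cos2 sin2)
next
  case (const c)
  show ?case by (rule trig_polynomial_const)
next
  case (add f g)
  then show ?case using trig_polynomial.add by simp
next
  case (mult f g)
  then show ?case using trig_polynomial_mult by simp
qed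

lemma integral_trig_polynomial_eq_0:
  assumes u: "C0_torus u" "\<And>k. fourier_coeff u k = 0" and "trig_polynomial p"
  shows "integral torus_box (\<lambda>\<phi>. complex_of_real (u \<phi>) * p \<phi>) = 0"
  using assms(3)
proof (induction rule: trig_polynomial.induct)
  case (monomial c m n)
  have "integral torus_box (\<lambda>\<phi>. complex_of_real (u \<phi>) * cis (of_int m * fst \<phi> + of_int n * snd \<phi>)) = 0"
    \<comment> \<open>\<open>fourier_coeff\<close> integrates against the conjugate character, hence
      the negated index.\<close>
    using u(2)[of "(- m, - n)"] by (simp add: fourier_coeff_def add.commute)
  then have "c * integral torus_box (\<lambda>\<phi>. complex_of_real (u \<phi>) * cis (of_int m * fst \<phi> + of_int n * snd \<phi>)) = 0"
    by simp
  then show ?case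
    by (simp only: integral_mult_right[symmetric]) (simp add: mult_ac)
next
  case (add p q)
  have cu: "continuous_on torus_box u"
    using u by (auto simp: C0_torus_def intro: continuous_on_subset)
  have "(\<lambda>\<phi>. complex_of_real (u \<phi>) * p \<phi>) integrable_on torus_box" if "trig_polynomial p" for p
    by (intro integrable_continuous continuous_intros cu trig_polynomial_continuous that)
  with add show ?case
    by (simp add: distrib_left integral_add)
qed

text \<open>If \<open>q\<close> is a trigonometric polynomial within \<open>e\<close> of \<open>u\<close>, then \<open>u\<close> is orthogonal to \<open>q\<close>, so the
  integral of \<open>u\<^sup>2 = u * (u - q) + u * q\<close> is at most \<open>e\<close> times that of \<open>\<bar>u\<bar>\<close>.\<close>

lemma fourier_coeff_eq_0_imp_eq_0:
  assumes u: "C0_torus u" "\<And>k. fourier_coeff u k = 0"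
  shows "u \<phi> = 0"
proof -
  obtain U where cU: "continuous_on (sphere 0 1 \<times> sphere 0 1) U"
    and U: "\<And>x y. U (cis x, cis y) = u (x, y)"
    using continuous_torus_factor[OF u(1)] by blast
  have cu: "continuous_on torus_box u"
    using u by (auto simp: C0_torus_def intro: continuous_on_subset)
  define M where "M = integral torus_box (\<lambda>\<phi>. \<bar>u \<phi>\<bar>)"
  have bound: "integral torus_box (\<lambda>\<phi>. (u \<phi>)\<^sup>2) \<le> e * M" if e: "e > 0" for e
  proof -
    obtain p where p: "real_polynomial_function p"
      "\<And>z. z \<in> sphere 0 1 \<times> sphere 0 1 \<Longrightarrow> \<bar>U z - p z\<bar> < e"
      using Stone_Weierstrass_real_polynomial_function[OF _ cU e] by (auto simp: compact_Times)
    define q where "q = (\<lambda>\<phi>. p (cis (fst \<phi>), cis (snd \<phi>)))"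
    have cq: "continuous_on torus_box q"
      unfolding q_def
      by (rule continuous_on_compose2[OF continuous_on_polymonial_function[of p UNIV]])
         (auto intro!: continuous_intros simp: p(1) simp flip: real_polynomial_function_eq)
    have "trig_polynomial (\<lambda>\<phi>. complex_of_real (q \<phi>))"
      unfolding q_def by (rule trig_polynomial_real_polynomial_function[OF p(1)])
    from integral_trig_polynomial_eq_0[OF u this]
    have "integral torus_box (\<lambda>\<phi>. complex_of_real (u \<phi> * q \<phi>)) = 0" by simp
    then have 0: "integral torus_box (\<lambda>\<phi>. u \<phi> * q \<phi>) = 0"
      using integral_linear[of "\<lambda>\<phi>. u \<phi> * q \<phi>" torus_box complex_of_real]
      by (simp add: o_def bounded_linear_of_real integrable_continuous continuous_intros cu cq)
    have "integral torus_box (\<lambda>\<phi>. (u \<phi>)\<^sup>2) = integral torus_box (\<lambda>\<phi>. (u \<phi>)\<^sup>2 - u \<phi> * q \<phi>)"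
      by (subst integral_diff) (auto intro!: integrable_continuous continuous_intros cu cq simp: 0)
    also have "\<dots> \<le> integral torus_box (\<lambda>\<phi>. e * \<bar>u \<phi>\<bar>)"
    proof (rule integral_le)
      fix \<phi>
      have "(u \<phi>)\<^sup>2 - u \<phi> * q \<phi> \<le> \<bar>u \<phi> - q \<phi>\<bar> * \<bar>u \<phi>\<bar>"
        by (simp add: power2_eq_square algebra_simps flip: abs_mult)
      also have "\<bar>u \<phi> - q \<phi>\<bar> \<le> e"
        using p(2)[of "(cis (fst \<phi>), cis (snd \<phi>))"] U[of "fst \<phi>" "snd \<phi>"] by (simp add: q_def)
      finally show "(u \<phi>)\<^sup>2 - u \<phi> * q \<phi> \<le> e * \<bar>u \<phi>\<bar>" by (simp add: mult_right_mono)
    qed (auto intro!: integrable_continuous continuous_intros cu cq)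
    finally show ?thesis by (simp add: M_def)
  qed
  have "M \<ge> 0" unfolding M_def by (rule integral_nonneg) (auto intro!: integrable_continuous continuous_intros cu)
  have "integral torus_box (\<lambda>\<phi>. (u \<phi>)\<^sup>2) \<le> 0"
  proof (rule field_le_epsilon)
    fix e :: real assume "e > 0"
    \<comment> \<open>Dividing by \<open>M + 1\<close> rather than \<open>M\<close> covers the case
      \<open>M = 0\<close>.\<close>
    have "e / (M + 1) * M \<le> e"
      using \<open>M \<ge> 0\<close> \<open>e > 0\<close> by (simp add: field_simps)
    then show "integral torus_box (\<lambda>\<phi>. (u \<phi>)\<^sup>2) \<le> 0 + e"
      using bound[of "e / (M + 1)"] \<open>M \<ge> 0\<close> \<open>e > 0\<close> by simp
  qed
  moreover have "integral torus_box (\<lambda>\<phi>. (u \<phi>)\<^sup>2) \<ge> 0"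
    by (rule integral_nonneg) (auto intro!: integrable_continuous continuous_intros cu)
  ultimately have "integral torus_box (\<lambda>\<phi>. (u \<phi>)\<^sup>2) = 0" by simp
  then have 0: "u \<theta> = 0" if "\<theta> \<in> torus_box" for \<theta>
    using that
    by (subst (asm) integral_cbox_eq_0_iff)
       (auto intro!: continuous_intros cu simp: box_ne_empty Basis_prod_def)
  obtain x y where \<phi>: "\<phi> = (x, y)" by (cases \<phi>)
  obtain s where s: "s \<in> {0..2*pi}" "cis s = cis x" by (rule cis_Arg_mod_2pi)
  obtain t where t: "t \<in> {0..2*pi}" "cis t = cis y" by (rule cis_Arg_mod_2pi)
  have "u (s, t) = u \<phi>"
    unfolding \<phi> using u(1) s t by (intro torus_fun_cong) (auto simp: C0_torus_def)
  with 0[of "(s, t)"] s t show ?thesis by (simp add: cbox_Pair_eq)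
qed

section \<open>Fourier coefficients of derivatives\<close>

lemma integral_derivative_torus_eq_0:
  fixes w :: "real \<times> real \<Rightarrow> 'a::banach"
  assumes per: "torus_fun w" and der: "\<And>\<phi>. (w has_derivative W \<phi>) (at \<phi>)"
    and cont: "\<And>v. continuous_on UNIV (\<lambda>\<phi>. W \<phi> v)"
  shows "integral torus_box (\<lambda>\<phi>. W \<phi> v) = 0"
proof -
  have c: "continuous_on A (\<lambda>\<phi>. W \<phi> v)" for A v
    using cont continuous_on_subset by blast
  \<comment> \<open>Along each coordinate the fundamental theorem of calculus is applied over a full
    period, where the endpoint values agree.\<close>
  have x: "((\<lambda>x. W (x, y) (1, 0)) has_integral 0) {0..2*pi}" for y
  proof -
    have "((\<lambda>x. W (x, y) (1, 0)) has_integral w (2 * pi, y) - w (0, y)) {0..2*pi}"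
    proof (rule fundamental_theorem_of_calculus)
      fix x
      have "((\<lambda>x. w (x, y)) has_derivative (\<lambda>h. W (x, y) (h, 0))) (at x)"
        by (rule has_derivative_compose[OF _ der]) (auto intro!: derivative_eq_intros)
      moreover have "(\<lambda>h. W (x, y) (h, 0)) = (\<lambda>h. h *\<^sub>R W (x, y) (1, 0))"
      proof
        fix h :: real
        have "W (x, y) (h *\<^sub>R (1, 0)) = h *\<^sub>R W (x, y) (1, 0)"
          by (rule linear_cmul[OF has_derivative_linear[OF der]])
        then show "W (x, y) (h, 0) = h *\<^sub>R W (x, y) (1, 0)" by simp
      qed
      ultimately show "((\<lambda>x. w (x, y)) has_vector_derivative W (x, y) (1, 0)) (at x within {0..2*pi})"
        unfolding has_vector_derivative_def by (metis has_derivative_at_withinI)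
    qed simp
    moreover have "w (2 * pi, y) = w (0, y)"
      using per torus_fun_def[of w] by (metis add_0)
    ultimately show ?thesis by simp
  qed
  have y: "((\<lambda>y. W (x, y) (0, 1)) has_integral 0) {0..2*pi}" for x
  proof -
    have "((\<lambda>y. W (x, y) (0, 1)) has_integral w (x, 2 * pi) - w (x, 0)) {0..2*pi}"
    proof (rule fundamental_theorem_of_calculus)
      fix y
      have "((\<lambda>y. w (x, y)) has_derivative (\<lambda>h. W (x, y) (0, h))) (at y)"
        by (rule has_derivative_compose[OF _ der]) (auto intro!: derivative_eq_intros)
      moreover have "(\<lambda>h. W (x, y) (0, h)) = (\<lambda>h. h *\<^sub>R W (x, y) (0, 1))"
      proof
        fix h :: real
        have "W (x, y) (h *\<^sub>R (0, 1)) = h *\<^sub>R W (x, y) (0, 1)"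
          by (rule linear_cmul[OF has_derivative_linear[OF der]])
        then show "W (x, y) (0, h) = h *\<^sub>R W (x, y) (0, 1)" by simp
      qed
      ultimately show "((\<lambda>y. w (x, y)) has_vector_derivative W (x, y) (0, 1)) (at y within {0..2*pi})"
        unfolding has_vector_derivative_def by (metis has_derivative_at_withinI)
    qed simp
    moreover have "w (x, 2 * pi) = w (x, 0)"
      using per torus_fun_def[of w] by (metis add_0)
    ultimately show ?thesis by simp
  qed
  have "integral torus_box (\<lambda>\<phi>. W \<phi> (1, 0)) =
      integral {0..2*pi} (\<lambda>x. integral {0..2*pi} (\<lambda>y. W (x, y) (1, 0)))"
    using integral_prod_continuous[OF c] by simp
  \<comment> \<open>The iterated integral has the second coordinate innermost; the order is
    exchanged so that the first partial derivative is integrated over its own period first.\<close>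
  also have "\<dots> = integral {0..2*pi} (\<lambda>y. integral {0..2*pi} (\<lambda>x. W (x, y) (1, 0)))"
    using integral_swap_continuous[of 0 0 "2*pi" "2*pi" "\<lambda>x y. W (x, y) (1, 0)"] c[of _ "(1, 0)"]
    by (simp add: case_prod_beta)
  also have "\<dots> = 0"
    by (simp add: integral_unique[OF x])
  finally have 1: "integral torus_box (\<lambda>\<phi>. W \<phi> (1, 0)) = 0" .
  have 2: "integral torus_box (\<lambda>\<phi>. W \<phi> (0, 1)) = 0"
    using integral_prod_continuous[OF c] by (simp add: integral_unique[OF y])
  have "W \<phi> v = fst v *\<^sub>R W \<phi> (1, 0) + snd v *\<^sub>R W \<phi> (0, 1)" for \<phi>
  proof -
    have lin: "linear (W \<phi>)" by (rule has_derivative_linear[OF der])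
    have "v = fst v *\<^sub>R (1, 0) + snd v *\<^sub>R (0, 1)" by (cases v) simp
    then show ?thesis by (metis linear_add[OF lin] linear_cmul[OF lin])
  qed
  then show ?thesis
    by (simp add: integral_add integrable_cmul integrable_continuous c 1 2)
qed

text \<open>Integration by parts: \<open>u\<close> times the conjugate character is periodic, so its
  directional derivative integrates to zero, and the product rule brings out the frequency in
  direction \<open>v\<close>.\<close>

lemma fourier_coeff_derivative:
  fixes u :: "real \<times> real \<Rightarrow> real"
  assumes u: "C1_torus u"
  shows "fourier_coeff (\<lambda>\<phi>. frechet_derivative u (at \<phi>) v) k =
    \<i> * of_real (of_int (fst k) * fst v + of_int (snd k) * snd v) * fourier_coeff u k"
proof -
  define K where "K = (\<lambda>\<phi>::real \<times> real. of_int (fst k) * fst \<phi> + of_int (snd k) * snd \<phi>)"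
  define E where "E = (\<lambda>\<phi>. cis (- K \<phi>))"
  let ?D = "\<lambda>\<phi> v. complex_of_real (frechet_derivative u (at \<phi>) v)"
  have der: "((\<lambda>\<phi>. complex_of_real (u \<phi>) * E \<phi>) has_derivative
      (\<lambda>v. ?D \<phi> v * E \<phi> - \<i> * of_real (K v) * (complex_of_real (u \<phi>) * E \<phi>))) (at \<phi>)" for \<phi>
  proof -
    have "(u has_derivative frechet_derivative u (at \<phi>)) (at \<phi>)"
      using u frechet_derivative_works unfolding C1_torus_def by blast
    then show ?thesis
      unfolding E_def K_def
      by (auto intro!: derivative_eq_intros has_derivative_of_real simp: algebra_simps scaleR_conv_of_real)
  qed
  have cu: "continuous_on A u" for A
    using u by (auto simp: C1_torus_def intro!: differentiable_imp_continuous_on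
      differentiable_at_imp_differentiable_on)
  have cD: "continuous_on A (\<lambda>\<phi>. frechet_derivative u (at \<phi>) v)" for A v
    using u continuous_on_subset unfolding C1_torus_def by blast
  have cE: "continuous_on A E" for A
    unfolding E_def K_def by (intro continuous_intros)
  have cis_2pi: "cis (a + 2 * pi * of_int n) = cis a" for a n
    by (simp flip: cis_mult)
  \<comment> \<open>Integrality of \<open>k\<close> makes the character periodic.\<close>
  have "E (x + 2 * pi, y) = E (x, y)" "E (x, y + 2 * pi) = E (x, y)" for x y
    using cis_2pi[of "- K (x, y)" "- fst k"] cis_2pi[of "- K (x, y)" "- snd k"]
    by (simp_all add: E_def K_def algebra_simps)
  with u have "torus_fun (\<lambda>\<phi>. complex_of_real (u \<phi>) * E \<phi>)"
    by (simp add: C1_torus_def torus_fun_def)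
  moreover have "continuous_on UNIV
      (\<lambda>\<phi>. ?D \<phi> v * E \<phi> - \<i> * of_real (K v) * (complex_of_real (u \<phi>) * E \<phi>))" for v
    by (intro continuous_intros cu cD cE)
  ultimately have "integral torus_box
      (\<lambda>\<phi>. ?D \<phi> v * E \<phi> - \<i> * of_real (K v) * (complex_of_real (u \<phi>) * E \<phi>)) = 0"
    by (rule integral_derivative_torus_eq_0[OF _ der])
  then have "integral torus_box (\<lambda>\<phi>. ?D \<phi> v * E \<phi>) =
     integral torus_box (\<lambda>\<phi>. \<i> * of_real (K v) * (complex_of_real (u \<phi>) * E \<phi>))"
    by (subst (asm) integral_diff) (auto intro!: integrable_continuous continuous_intros cu cD cE)
  then have "integral torus_box (\<lambda>\<phi>. ?D \<phi> v * E \<phi>) =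
      \<i> * of_real (K v) * integral torus_box (\<lambda>\<phi>. complex_of_real (u \<phi>) * E \<phi>)"
    by (simp only: integral_mult_right)
  then show ?thesis
    by (simp add: fourier_coeff_def E_def K_def)
qed

lemma fourier_coeff_diff:
  assumes "C0_torus u" "C0_torus v"
  shows "fourier_coeff (\<lambda>\<phi>. u \<phi> - v \<phi>) k = fourier_coeff u k - fourier_coeff v k"
proof -
  have "continuous_on torus_box u" "continuous_on torus_box v"
    using assms by (auto simp: C0_torus_def intro: continuous_on_subset)
  then show ?thesis
    unfolding fourier_coeff_def of_real_diff left_diff_distrib
    by (subst integral_diff)
       (auto intro!: integrable_continuous continuous_intros simp: diff_divide_distrib)
qed

lemma fourier_coeff_uminus: "fourier_coeff (\<lambda>\<phi>. - u \<phi>) k = - fourier_coeff u k"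
  by (simp add: fourier_coeff_def)

lemma fourier_coeff_cmult:
  "fourier_coeff (\<lambda>\<phi>. c * u \<phi>) k = complex_of_real c * fourier_coeff u k"
  by (simp add: fourier_coeff_def mult.assoc)

subsection \<open>Continuously differentiable functions on the torus\<close>

lemma C1_torus_imp_C0_torus: "C1_torus u \<Longrightarrow> C0_torus u"
  unfolding C1_torus_def C0_torus_def
  using differentiable_imp_continuous_on differentiable_at_imp_differentiable_on by blast

lemma C1_torusI:
  assumes "torus_fun u" and der: "\<And>\<phi>. (u has_derivative u' \<phi>) (at \<phi>)"
    and "\<And>v. continuous_on UNIV (\<lambda>\<phi>. u' \<phi> v)"
  shows "C1_torus u"
proof -
  have "frechet_derivative u (at \<phi>) = u' \<phi>" for \<phi>
    using frechet_derivative_at[OF der] by simp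
  with assms show ?thesis
    unfolding C1_torus_def using differentiableI[OF der] by simp
qed

lemma C1_torus_has_derivative:
  "C1_torus u \<Longrightarrow> (u has_derivative frechet_derivative u (at \<phi>)) (at \<phi>)"
  using frechet_derivative_works unfolding C1_torus_def by blast

lemma C1_torus_continuous_derivative:
  "C1_torus u \<Longrightarrow> continuous_on UNIV (\<lambda>\<phi>. frechet_derivative u (at \<phi>) v)"
  unfolding C1_torus_def by blast

lemma C1_torus_diff:
  assumes "C1_torus u" "C1_torus v"
  shows "C1_torus (\<lambda>\<phi>. u \<phi> - v \<phi>)"
proof (rule C1_torusI)
  show "torus_fun (\<lambda>\<phi>. u \<phi> - v \<phi>)"
    using assms by (simp add: C1_torus_def torus_fun_def)
  show "((\<lambda>\<phi>. u \<phi> - v \<phi>) has_derivative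
    (\<lambda>x. frechet_derivative u (at \<phi>) x - frechet_derivative v (at \<phi>) x)) (at \<phi>)" for \<phi>
    by (intro has_derivative_diff C1_torus_has_derivative assms)
qed (intro continuous_intros C1_torus_continuous_derivative assms)

lemma C1_torus_Pair:
  assumes "C1_torus u" "C1_torus v"
  shows "C1_torus (\<lambda>\<phi>. (u \<phi>, v \<phi>))"
proof (rule C1_torusI)
  show "torus_fun (\<lambda>\<phi>. (u \<phi>, v \<phi>))"
    using assms by (simp add: C1_torus_def torus_fun_def)
  show "((\<lambda>\<phi>. (u \<phi>, v \<phi>)) has_derivative
    (\<lambda>x. (frechet_derivative u (at \<phi>) x, frechet_derivative v (at \<phi>) x))) (at \<phi>)" for \<phi>
    by (intro has_derivative_Pair C1_torus_has_derivative assms)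
qed (intro continuous_intros C1_torus_continuous_derivative assms)

lemma C1_torus_fst: "C1_torus u \<Longrightarrow> C1_torus (\<lambda>\<phi>. fst (u \<phi>))"
  by (rule C1_torusI[where u' = "\<lambda>\<phi> v. fst (frechet_derivative u (at \<phi>) v)"])
     (auto simp: torus_fun_def C1_torus_def
        intro!: has_derivative_fst C1_torus_has_derivative continuous_intros)

lemma C1_torus_snd: "C1_torus u \<Longrightarrow> C1_torus (\<lambda>\<phi>. snd (u \<phi>))"
  by (rule C1_torusI[where u' = "\<lambda>\<phi> v. snd (frechet_derivative u (at \<phi>) v)"])
     (auto simp: torus_fun_def C1_torus_def
        intro!: has_derivative_snd C1_torus_has_derivative continuous_intros)

text \<open>All tangential and normal data of the reduction turn out to have this form. The factor
  \<open>fst v - snd v\<close> makes such functions constant along \<omega>, whose two entries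
  agree.\<close>

lemma
  assumes per: "\<And>x::real. p (x + 2 * pi) = p x"
    and der: "\<And>x. (p has_real_derivative p' x) (at x)"
    and cont: "continuous_on UNIV p'"
  shows C1_torus_phase_difference: "C1_torus (\<lambda>\<phi>. p (fst \<phi> - snd \<phi>))"
    and frechet_derivative_phase_difference:
      "frechet_derivative (\<lambda>\<phi>. p (fst \<phi> - snd \<phi>)) (at \<phi>) v = p' (fst \<phi> - snd \<phi>) * (fst v - snd v)"
proof -
  have D: "((\<lambda>\<phi>. p (fst \<phi> - snd \<phi>)) has_derivative (\<lambda>v. p' (fst \<phi> - snd \<phi>) * (fst v - snd v))) (at \<phi>)"
    for \<phi> :: "real \<times> real"
    by (rule has_derivative_compose[of "\<lambda>\<phi>. fst \<phi> - snd \<phi>", OF _ der[unfolded has_field_derivative_def]])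
       (auto intro!: derivative_eq_intros)
  have "p (x - (y + 2 * pi)) = p (x - y)" for x y
    using per[of "x - (y + 2 * pi)"] by (simp add: algebra_simps)
  moreover have "p (x + 2 * pi - y) = p (x - y)" for x y
    using per[of "x - y"] by (simp add: algebra_simps)
  ultimately have "torus_fun (\<lambda>\<phi>. p (fst \<phi> - snd \<phi>))"
    by (simp add: torus_fun_def)
  then show "C1_torus (\<lambda>\<phi>. p (fst \<phi> - snd \<phi>))"
    by (rule C1_torusI[OF _ D]) (intro continuous_intros continuous_on_compose2[OF cont], auto)
  show "frechet_derivative (\<lambda>\<phi>. p (fst \<phi> - snd \<phi>)) (at \<phi>) v = p' (fst \<phi> - snd \<phi>) * (fst v - snd v)"
    using frechet_derivative_at[OF D] by metis
qed

subsection \<open>The homological equations\<close>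

context stuart_landau
begin

lemma fourier_coeff_D\<omega>:
  assumes "C1_torus u"
  shows "fourier_coeff (D\<omega> u) k =
    \<i> * of_real (of_int (fst k) * fst \<omega> + of_int (snd k) * snd \<omega>) * fourier_coeff u k"
  using fourier_coeff_derivative[OF assms] by (simp add: D\<omega>_def[abs_def])

lemma D\<omega>_diff:
  "C1_torus u \<Longrightarrow> C1_torus v \<Longrightarrow> D\<omega> (\<lambda>\<phi>. u \<phi> - v \<phi>) \<phi> = D\<omega> u \<phi> - D\<omega> v \<phi>"
  unfolding D\<omega>_def
  by (subst frechet_derivative_at[symmetric, OF has_derivative_diff])
     (auto intro: C1_torus_has_derivative)

lemma D\<omega>_fst: "C1_torus u \<Longrightarrow> D\<omega> (\<lambda>\<phi>. fst (u \<phi>)) \<phi> = fst (D\<omega> u \<phi>)"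
  unfolding D\<omega>_def
  by (subst frechet_derivative_at[symmetric, OF has_derivative_fst])
     (auto intro: C1_torus_has_derivative)

lemma D\<omega>_snd: "C1_torus u \<Longrightarrow> D\<omega> (\<lambda>\<phi>. snd (u \<phi>)) \<phi> = snd (D\<omega> u \<phi>)"
  unfolding D\<omega>_def
  by (subst frechet_derivative_at[symmetric, OF has_derivative_snd])
     (auto intro: C1_torus_has_derivative)

lemma D\<omega>_Pair:
  "C1_torus u \<Longrightarrow> C1_torus v \<Longrightarrow> D\<omega> (\<lambda>\<phi>. (u \<phi>, v \<phi>)) \<phi> = (D\<omega> u \<phi>, D\<omega> v \<phi>)"
  using D\<omega>_fst[OF C1_torus_Pair, of u v \<phi>] D\<omega>_snd[OF C1_torus_Pair, of u v \<phi>] by (simp add: prod_eq_iff)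

text \<open>On coefficients the equation says that \<open>\<i> * (k \<bullet> \<omega>)\<close>
  times that of \<open>g\<close> plus that of \<open>f\<close> is zero. For resonant
  \<open>k\<close> the first term vanishes and forces the coefficient of \<open>f\<close> to vanish;
  for the others \<open>f\<close> contributes nothing and the nonzero factor can be divided out.
  Completeness then gives both functions.\<close>

lemma homological_equation_unique:
  assumes g: "C1_torus g" "\<And>k. resonant k \<Longrightarrow> fourier_coeff g k = 0"
    and f: "C0_torus f" "\<And>k. \<not> resonant k \<Longrightarrow> fourier_coeff f k = 0"
    and eq: "\<And>\<phi>. D\<omega> g \<phi> + f \<phi> = 0"
  shows "g \<phi> = 0" "f \<phi> = 0"
proof -
  have "f = (\<lambda>\<phi>. - D\<omega> g \<phi>)" using eq by (auto simp: add_eq_0_iff)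
  then have f_eq: "fourier_coeff f k =
      - (\<i> * of_real (of_int (fst k) * fst \<omega> + of_int (snd k) * snd \<omega>) * fourier_coeff g k)" for k
    using fourier_coeff_uminus[of "D\<omega> g" k] fourier_coeff_D\<omega>[OF g(1)] by simp
  have "fourier_coeff f k = 0" for k
  proof (cases "resonant k")
    case True
    then have "of_int (fst k) * fst \<omega> + of_int (snd k) * snd \<omega> = 0" by (simp add: resonant_def)
    then show ?thesis by (simp only: f_eq) simp
  qed (rule f(2))
  then show "f \<phi> = 0" by (rule fourier_coeff_eq_0_imp_eq_0[OF f(1)])
  have "fourier_coeff g k = 0" for k
  proof (cases "resonant k")
    case False
    then have "of_int (fst k) * fst \<omega> + of_int (snd k) * snd \<omega> \<noteq> 0" by (simp add: resonant_def)
    then show ?thesis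
      using f_eq[of k] f(2)[OF False] by (simp del: of_real_add)
  qed (rule g(2))
  then show "g \<phi> = 0" by (rule fourier_coeff_eq_0_imp_eq_0[OF C1_torus_imp_C0_torus[OF g(1)]])
qed

text \<open>Each coefficient is multiplied by \<open>\<i> * m + c\<close>, whose real part
  \<open>c\<close> is nonzero, so resonance cannot occur and no Fourier condition on
  \<open>h\<close> is imposed.\<close>

lemma damped_transport_unique:
  fixes h :: "real \<times> real \<Rightarrow> real"
  assumes h: "C1_torus h" and eq: "\<And>\<phi>. D\<omega> h \<phi> + c * h \<phi> = 0" and c: "c \<noteq> 0"
  shows "h \<phi> = 0"
proof (rule fourier_coeff_eq_0_imp_eq_0[OF C1_torus_imp_C0_torus[OF h]])
  fix k
  define m where "m = of_int (fst k) * fst \<omega> + of_int (snd k) * snd \<omega>"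
  have "D\<omega> h = (\<lambda>\<phi>. - c * h \<phi>)" using eq by (auto simp: eq_neg_iff_add_eq_0)
  then have "\<i> * of_real m * fourier_coeff h k = of_real (- c) * fourier_coeff h k"
    unfolding m_def using fourier_coeff_D\<omega>[OF h, of k] fourier_coeff_cmult[of "- c" h k] by metis
  then have "(\<i> * of_real m + of_real c) * fourier_coeff h k = 0"
    by (simp add: algebra_simps)
  moreover have "\<i> * of_real m + of_real c \<noteq> 0"
    using c by (simp add: complex_eq_iff)
  ultimately show "fourier_coeff h k = 0" by simp
qed

end

section \<open>The rotating frame and uniqueness of the selected solutions\<close>

locale stuart_landau_reduction = stuart_landau +
  assumes \<alpha>\<gamma>: "\<alpha> * \<gamma> < 0" and delay_pos: "\<tau> > 0"
begin

lemma parameters_nonzero: "\<alpha> \<noteq> 0" "\<gamma> \<noteq> 0"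
  using \<alpha>\<gamma> by auto

lemma R_pos: "R > 0"
  using \<alpha>\<gamma> by (auto simp: R_def field_simps mult_less_0_iff zero_less_mult_iff divide_less_0_iff)

lemma \<gamma>_R: "\<gamma> * R\<^sup>2 = - \<alpha>"
proof -
  \<comment> \<open>The real \<open>sqrt\<close> is odd, so a positive value forces a positive
    radicand.\<close>
  have "- \<alpha> / \<gamma> \<ge> 0" using R_pos by (simp add: R_def)
  then show ?thesis by (simp add: R_def parameters_nonzero)
qed

lemma T_inject: "T \<phi> u = T \<phi> v \<longleftrightarrow> u = v"
  using R_pos by (auto simp: T_eq prod_eq_iff)

lemma N_inject: "N \<phi> u = N \<phi> v \<longleftrightarrow> u = v"
  by (auto simp: N_def prod_eq_iff parameters_nonzero)

text \<open>Once \<open>cis\<close> of the phase is factored out, \<open>T\<close> contributes the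
  imaginary number \<open>\<i> * R * u\<close> and \<open>N\<close> the real number
  \<open>\<gamma> * n\<close> in each component. As \<open>R\<close> and \<gamma> are nonzero, the
  two images are complementary.\<close>

lemma frame_decomposition:
  "(cis (fst \<phi>) * z, cis (snd \<phi>) * w) = T \<phi> u + N \<phi> n \<longleftrightarrow>
    u = (Im z / R, Im w / R) \<and> n = (Re z / \<gamma>, Re w / \<gamma>)"
proof -
  have "cis a * z = \<i> * of_real R * cis a * of_real x + of_real \<gamma> * cis a * of_real y \<longleftrightarrow>
      x = Im z / R \<and> y = Re z / \<gamma>" for a z x y
  proof -
    have "\<i> * of_real R * cis a * of_real x + of_real \<gamma> * cis a * of_real y =
        cis a * (\<i> * of_real R * of_real x + of_real \<gamma> * of_real y)"
      by (simp add: algebra_simps)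
    then show ?thesis
      using R_pos parameters_nonzero
      by (simp only: mult_cancel_left cis_neq_zero) (auto simp: complex_eq_iff field_simps)
  qed
  then show ?thesis by (auto simp: T_eq N_def prod_eq_iff)
qed

text \<open>Uniqueness of the decomposition gives the definite description in \<open>proj\<close>
  its value, the \<open>T\<close> part; the \<open>N\<close> part is the remainder.\<close>

lemma
  shows proj_frame: "proj \<phi> (cis (fst \<phi>) * z, cis (snd \<phi>) * w) = T \<phi> (Im z / R, Im w / R)" (is ?P)
    and complement_frame: "(cis (fst \<phi>) * z, cis (snd \<phi>) * w) - proj \<phi> (cis (fst \<phi>) * z, cis (snd \<phi>) * w)
      = N \<phi> (Re z / \<gamma>, Re w / \<gamma>)"
proof -
  let ?v = "(cis (fst \<phi>) * z, cis (snd \<phi>) * w)"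
  have v: "?v = T \<phi> (Im z / R, Im w / R) + N \<phi> (Re z / \<gamma>, Re w / \<gamma>)"
    using frame_decomposition by blast
  show p: ?P
    unfolding proj_def
  proof (rule the_equality)
    show "T \<phi> (Im z / R, Im w / R) \<in> range (T \<phi>) \<and> ?v - T \<phi> (Im z / R, Im w / R) \<in> range (N \<phi>)"
      using v by simp
  next
    fix x assume "x \<in> range (T \<phi>) \<and> ?v - x \<in> range (N \<phi>)"
    then obtain u n where "x = T \<phi> u" "?v - x = N \<phi> n" by blast
    then have "?v = T \<phi> u + N \<phi> n" by (metis add.commute diff_add_cancel)
    with \<open>x = T \<phi> u\<close> show "x = T \<phi> (Im z / R, Im w / R)"
      using frame_decomposition[of \<phi> z w u n] by simp
  qed
  show "?v - proj \<phi> ?v = N \<phi> (Re z / \<gamma>, Re w / \<gamma>)"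
    unfolding p using v by simp
qed

text \<open>\<open>T\<close> is injective, so each component of the difference of two solutions
  solves the homogeneous homological equation. With existence, this evaluates the definite
  descriptions behind \<open>g1\<close>, \<open>f1\<close> and \<open>f2\<close>.\<close>

lemma tangential_solution_unique:
  assumes "tangential_solution \<eta> (g, f)" "tangential_solution \<eta> (g', f')"
  shows "g = g'" "f = f'"
proof -
  have g: "C1_torus g" "C1_torus g'" and f: "C0_torus f" "C0_torus f'"
    and T: "T \<phi> (D\<omega> g \<phi> + f \<phi>) = T \<phi> (D\<omega> g' \<phi> + f' \<phi>)" for \<phi>
    using assms by (simp_all add: tangential_solution_def del: split_paired_All)
  have eq: "D\<omega> (\<lambda>\<phi>. g \<phi> - g' \<phi>) \<phi> + (f \<phi> - f' \<phi>) = 0" for \<phi>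
    using T[of \<phi>] by (simp add: T_inject D\<omega>_diff g algebra_simps)
  have C1: "C1_torus (\<lambda>\<phi>. g \<phi> - g' \<phi>)" by (rule C1_torus_diff[OF g])
  have C0: "C0_torus (\<lambda>\<phi>. fst (f \<phi>))" "C0_torus (\<lambda>\<phi>. fst (f' \<phi>))"
      "C0_torus (\<lambda>\<phi>. snd (f \<phi>))" "C0_torus (\<lambda>\<phi>. snd (f' \<phi>))"
    using f by (auto simp: C0_torus_def torus_fun_def intro!: continuous_intros)
  have C0d: "C0_torus (\<lambda>\<phi>. fst (f \<phi> - f' \<phi>))" "C0_torus (\<lambda>\<phi>. snd (f \<phi> - f' \<phi>))"
    using f by (auto simp: C0_torus_def torus_fun_def intro!: continuous_intros)
  note C0' = C1_torus_imp_C0_torus[OF C1_torus_fst[OF g(1)]] C1_torus_imp_C0_torus[OF C1_torus_fst[OF g(2)]]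
    C1_torus_imp_C0_torus[OF C1_torus_snd[OF g(1)]] C1_torus_imp_C0_torus[OF C1_torus_snd[OF g(2)]]
  have res: "fourier_coeff (\<lambda>\<phi>. fst (g \<phi> - g' \<phi>)) k = 0" "fourier_coeff (\<lambda>\<phi>. snd (g \<phi> - g' \<phi>)) k = 0"
    if "resonant k" for k
    using that assms
    by (simp_all add: tangential_solution_def fourier_coeff2_def fourier_coeff_diff C0' zero_prod_def
        del: split_paired_All)
  have nonres: "fourier_coeff (\<lambda>\<phi>. fst (f \<phi> - f' \<phi>)) k = 0" "fourier_coeff (\<lambda>\<phi>. snd (f \<phi> - f' \<phi>)) k = 0"
    if "\<not> resonant k" for k
    using that assms
    by (simp_all add: tangential_solution_def fourier_coeff2_def fourier_coeff_diff C0 zero_prod_def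
        del: split_paired_All)
  have "D\<omega> (\<lambda>\<phi>. fst (g \<phi> - g' \<phi>)) \<phi> + fst (f \<phi> - f' \<phi>) = 0"
       "D\<omega> (\<lambda>\<phi>. snd (g \<phi> - g' \<phi>)) \<phi> + snd (f \<phi> - f' \<phi>) = 0" for \<phi>
    using eq[of \<phi>] by (simp_all only: D\<omega>_fst[OF C1] D\<omega>_snd[OF C1]) (simp_all add: prod_eq_iff)
  from homological_equation_unique[OF C1_torus_fst[OF C1] res(1) C0d(1) nonres(1) this(1)]
    homological_equation_unique[OF C1_torus_snd[OF C1] res(2) C0d(2) nonres(2) this(2)]
  show "g = g'" "f = f'" by (auto simp: fun_eq_iff prod_eq_iff)
qed

text \<open>\<open>N\<close> is injective and \<open>- L\<close> is multiplication by
  \<open>2 * \<alpha>\<close>, so the components of the difference satisfy the damped equation with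
  \<open>c = 2 * \<alpha>\<close>.\<close>

lemma normal_solution_unique:
  assumes "normal_solution \<eta> h" "normal_solution \<eta> h'"
  shows "h = h'"
proof -
  have h: "C1_torus h" "C1_torus h'"
    and N: "N \<phi> (D\<omega> h \<phi> - L (h \<phi>)) = N \<phi> (D\<omega> h' \<phi> - L (h' \<phi>))" for \<phi>
    using assms by (simp_all add: normal_solution_def del: split_paired_All)
  have C1: "C1_torus (\<lambda>\<phi>. h \<phi> - h' \<phi>)" by (rule C1_torus_diff[OF h])
  have eq: "D\<omega> (\<lambda>\<phi>. h \<phi> - h' \<phi>) \<phi> = - (2 * \<alpha>) *\<^sub>R (h \<phi> - h' \<phi>)" for \<phi>
  proof -
    have "D\<omega> h \<phi> - L (h \<phi>) = D\<omega> h' \<phi> - L (h' \<phi>)"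
      using N[of \<phi>] by (simp add: N_inject)
    then have "D\<omega> h \<phi> - D\<omega> h' \<phi> = L (h \<phi>) - L (h' \<phi>)"
      by (simp add: algebra_simps)
    then show ?thesis
      by (simp add: D\<omega>_diff h L_def scaleR_diff_right)
  qed
  have "D\<omega> (\<lambda>\<phi>. fst (h \<phi> - h' \<phi>)) \<phi> + 2 * \<alpha> * fst (h \<phi> - h' \<phi>) = 0"
       "D\<omega> (\<lambda>\<phi>. snd (h \<phi> - h' \<phi>)) \<phi> + 2 * \<alpha> * snd (h \<phi> - h' \<phi>) = 0" for \<phi>
    unfolding D\<omega>_fst[OF C1] D\<omega>_snd[OF C1] eq by simp_all
  from damped_transport_unique[OF C1_torus_fst[OF C1] this(1)]
    damped_transport_unique[OF C1_torus_snd[OF C1] this(2)]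
  show ?thesis
    by (auto simp: fun_eq_iff prod_eq_iff parameters_nonzero)
qed

section \<open>Right-hand sides that depend on the phase difference alone\<close>

lemma D\<omega>_phase_difference:
  assumes "\<And>x. p (x + 2 * pi) = p x" "\<And>x. (p has_real_derivative p' x) (at x)" "continuous_on UNIV p'"
  shows "D\<omega> (\<lambda>\<phi>. p (fst \<phi> - snd \<phi>)) \<phi> = 0"
  unfolding D\<omega>_def by (subst frechet_derivative_phase_difference[OF assms]) (simp add: \<omega>_def)

text \<open>No integral is computed: the derivative along \<omega> is zero, so the coefficient times
  \<open>k \<bullet> \<omega>\<close> is zero.\<close>

lemma fourier_coeff_phase_difference:
  assumes p: "\<And>x. p (x + 2 * pi) = p x" "\<And>x. (p has_real_derivative p' x) (at x)" "continuous_on UNIV p'"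
    and k: "\<not> resonant k"
  shows "fourier_coeff (\<lambda>\<phi>. p (fst \<phi> - snd \<phi>)) k = 0"
proof -
  have "D\<omega> (\<lambda>\<phi>. p (fst \<phi> - snd \<phi>)) = (\<lambda>_. 0)"
    using D\<omega>_phase_difference[OF p] by blast
  then have "fourier_coeff (D\<omega> (\<lambda>\<phi>. p (fst \<phi> - snd \<phi>))) k = 0"
    by (simp add: fourier_coeff_def)
  with fourier_coeff_D\<omega>[OF C1_torus_phase_difference[OF p], of k] k show ?thesis
    by (simp add: resonant_def del: of_real_add of_real_mult)
qed

text \<open>The factor \<open>R\<close> in the hypotheses is the one that \<open>T\<close> carries,
  so \<open>p\<close> and \<open>q\<close> are the components of \<open>f\<close> itself. They are
  already in normal form, and \<open>g = 0\<close> completes the pair.\<close>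

lemma tangential_solution_phase_difference:
  assumes \<eta>: "\<And>\<phi>. Im (cis (- fst \<phi>) * fst (\<eta> \<phi>)) = R * p (fst \<phi> - snd \<phi>)"
      "\<And>\<phi>. Im (cis (- snd \<phi>) * snd (\<eta> \<phi>)) = R * q (fst \<phi> - snd \<phi>)"
    and p: "\<And>x. p (x + 2 * pi) = p x" "\<And>x. (p has_real_derivative p' x) (at x)" "continuous_on UNIV p'"
    and q: "\<And>x. q (x + 2 * pi) = q x" "\<And>x. (q has_real_derivative q' x) (at x)" "continuous_on UNIV q'"
  shows "(THE s. tangential_solution \<eta> s) =
    (\<lambda>_. 0, \<lambda>\<phi>. (p (fst \<phi> - snd \<phi>), q (fst \<phi> - snd \<phi>)))"
proof (rule the_equality)
  let ?f = "\<lambda>\<phi>. (p (fst \<phi> - snd \<phi>), q (fst \<phi> - snd \<phi>))"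
  have "proj \<phi> (\<eta> \<phi>) = T \<phi> (?f \<phi>)" for \<phi>
  proof -
    have "\<eta> \<phi> = (cis (fst \<phi>) * (cis (- fst \<phi>) * fst (\<eta> \<phi>)), cis (snd \<phi>) * (cis (- snd \<phi>) * snd (\<eta> \<phi>)))"
      by (simp add: cis_mult flip: mult.assoc)
    then show ?thesis
      using proj_frame[of \<phi> "cis (- fst \<phi>) * fst (\<eta> \<phi>)" "cis (- snd \<phi>) * snd (\<eta> \<phi>)"] R_pos
      unfolding \<eta> by simp
  qed
  moreover have "C1_torus (\<lambda>_. 0 :: real \<times> real)"
    by (rule C1_torusI[where u' = "\<lambda>_ _. 0"]) (auto simp: torus_fun_def)
  moreover have "C0_torus ?f"
    by (intro C1_torus_imp_C0_torus C1_torus_Pair C1_torus_phase_difference[OF p] C1_torus_phase_difference[OF q])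
  moreover have "fourier_coeff2 (\<lambda>_. 0) k = 0" for k
    by (simp add: fourier_coeff2_def fourier_coeff_def zero_prod_def)
  moreover have "fourier_coeff2 ?f k = 0" if "\<not> resonant k" for k
    using fourier_coeff_phase_difference[OF p that] fourier_coeff_phase_difference[OF q that]
    by (simp add: fourier_coeff2_def zero_prod_def)
  ultimately show sol: "tangential_solution \<eta> (\<lambda>_. 0, ?f)"
    by (simp add: tangential_solution_def D\<omega>_def)
  show "s = (\<lambda>_. 0, ?f)" if "tangential_solution \<eta> s" for s
    using that tangential_solution_unique[OF _ sol] by (cases s) auto
qed

text \<open>In the factor \<open>2 * \<alpha> * \<gamma>\<close>, \<gamma> comes from
  \<open>N\<close> and \<open>2 * \<alpha>\<close> from \<open>- L\<close>; the transport term
  vanishes.\<close>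

lemma normal_solution_phase_difference:
  assumes \<eta>: "\<And>\<phi>. Re (cis (- fst \<phi>) * fst (\<eta> \<phi>)) = 2 * \<alpha> * \<gamma> * p (fst \<phi> - snd \<phi>)"
      "\<And>\<phi>. Re (cis (- snd \<phi>) * snd (\<eta> \<phi>)) = 2 * \<alpha> * \<gamma> * q (fst \<phi> - snd \<phi>)"
    and p: "\<And>x. p (x + 2 * pi) = p x" "\<And>x. (p has_real_derivative p' x) (at x)" "continuous_on UNIV p'"
    and q: "\<And>x. q (x + 2 * pi) = q x" "\<And>x. (q has_real_derivative q' x) (at x)" "continuous_on UNIV q'"
  shows "(THE h. normal_solution \<eta> h) = (\<lambda>\<phi>. (p (fst \<phi> - snd \<phi>), q (fst \<phi> - snd \<phi>)))"
proof (rule the_equality)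
  let ?h = "\<lambda>\<phi>. (p (fst \<phi> - snd \<phi>), q (fst \<phi> - snd \<phi>))"
  have "\<eta> \<phi> - proj \<phi> (\<eta> \<phi>) = N \<phi> ((2 * \<alpha>) *\<^sub>R ?h \<phi>)" for \<phi>
  proof -
    have "\<eta> \<phi> = (cis (fst \<phi>) * (cis (- fst \<phi>) * fst (\<eta> \<phi>)), cis (snd \<phi>) * (cis (- snd \<phi>) * snd (\<eta> \<phi>)))"
      by (simp add: cis_mult flip: mult.assoc)
    then show ?thesis
      using complement_frame[of \<phi> "cis (- fst \<phi>) * fst (\<eta> \<phi>)" "cis (- snd \<phi>) * snd (\<eta> \<phi>)"]
      unfolding \<eta> by (simp add: parameters_nonzero mult.assoc)
  qed
  moreover have "C1_torus ?h" and "D\<omega> ?h \<phi> = 0" for \<phi>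
    using C1_torus_phase_difference[OF p] C1_torus_phase_difference[OF q]
      D\<omega>_phase_difference[OF p] D\<omega>_phase_difference[OF q]
    by (simp_all add: C1_torus_Pair D\<omega>_Pair zero_prod_def)
  ultimately show sol: "normal_solution \<eta> ?h"
    by (simp add: normal_solution_def L_def)
  show "h = ?h" if "normal_solution \<eta> h" for h
    using normal_solution_unique[OF that sol] .
qed

end

subsection \<open>Derivatives of the vector field and of the coupling\<close>

lemma frechet_derivative_eqI: "(f has_derivative f') (at x) \<Longrightarrow> frechet_derivative f (at x) = f'"
  using frechet_derivative_at by metis

lemma cis_uminus_cancel: "cis (- t) * (cis t * z) = z"
  by (simp add: cis_mult flip: mult.assoc)

lemma cis_uminus_mult: "cis (- t) * (a * cis t * z) = a * z"
  using cis_uminus_cancel[of t "a * z"] by (simp only: mult_ac)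

text \<open>In the frame \<open>cis (a x)\<close> the real part of the derivative is the change of
  radius and the imaginary part is the radius times the change of angle.\<close>

lemma has_derivative_polar:
  assumes "(c has_derivative c') (at x)" "(a has_derivative a') (at x)"
  shows "((\<lambda>x. complex_of_real (c x) * cis (a x)) has_derivative
    (\<lambda>u. cis (a x) * Complex (c' u) (c x * a' u))) (at x)"
  by (auto intro!: derivative_eq_intros has_derivative_of_real assms
      simp: Complex_eq scaleR_conv_of_real algebra_simps fun_eq_iff)

lemma bounded_linear_apply_bcontfun: "bounded_linear (\<lambda>Z. apply_bcontfun Z s)"
  by (rule bounded_linear_intro[where K = 1]) (auto simp: norm_bounded)

context stuart_landau
begin

text \<open>Evaluation at a point has norm at most 1 for the sup norm, so \<open>G\<close> is its
  own Frechet derivative everywhere.\<close>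

lemma bounded_linear_G: "bounded_linear G"
proof -
  have 1: "bounded_linear (\<lambda>Z. fst (apply_bcontfun Z s))"
    and 2: "bounded_linear (\<lambda>Z. snd (apply_bcontfun Z s))"
    for s
    using bounded_linear_apply_bcontfun
    by (rule bounded_linear_compose[OF bounded_linear_fst] bounded_linear_compose[OF bounded_linear_snd])+
  show ?thesis
    unfolding G_def[abs_def]
    by (intro bounded_linear_Pair bounded_linear_const_mult bounded_linear_sub 1 2)
qed

lemma frechet_derivative_G: "frechet_derivative G (at X) = G"
  by (intro frechet_derivative_eqI bounded_linear_imp_has_derivative bounded_linear_G)

lemma G_segment:
  assumes "continuous_on {- \<tau>..0} Z" "\<tau> \<ge> 0"
  shows "G (segment Z) = (cis \<rho> * (snd (Z (- \<tau>)) - fst (Z 0)), cis \<rho> * (fst (Z (- \<tau>)) - snd (Z 0)))"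
  using assms by (simp add: G_def apply_segment)

text \<open>The real derivative of \<open>sl\<close>, which is not holomorphic; the squared modulus
  is treated as the bilinear expression \<open>z \<bullet> z\<close>.\<close>

definition dsl :: "complex \<Rightarrow> complex \<Rightarrow> complex" where
  "dsl z v = Complex \<alpha> \<beta> * v + of_real (2 * \<gamma> * (z \<bullet> v)) * z + of_real (\<gamma> * (z \<bullet> z)) * v"

definition d2sl :: "complex \<Rightarrow> complex \<Rightarrow> complex \<Rightarrow> complex" where
  "d2sl z v w = of_real (2 * \<gamma> * (w \<bullet> v)) * z + of_real (2 * \<gamma> * (z \<bullet> v)) * w + of_real (2 * \<gamma> * (z \<bullet> w)) * v"

lemma sl_has_derivative: "(sl has_derivative dsl z) (at z)"
proof -
  have "(sl has_derivative (\<lambda>v. Complex \<alpha> \<beta> * v + (of_real (\<gamma> * (z \<bullet> z)) * v + of_real (\<gamma> * (z \<bullet> v + v \<bullet> z)) * z))) (at z)"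
    unfolding sl_def[abs_def] power2_norm_eq_inner
    by (rule derivative_eq_intros has_derivative_of_real refl)+ simp
  moreover have "(\<lambda>v. Complex \<alpha> \<beta> * v + (of_real (\<gamma> * (z \<bullet> z)) * v + of_real (\<gamma> * (z \<bullet> v + v \<bullet> z)) * z)) = dsl z"
    by (auto simp: dsl_def fun_eq_iff inner_commute algebra_simps)
  ultimately show ?thesis by simp
qed

lemma dsl_has_derivative: "((\<lambda>z. dsl z v) has_derivative d2sl z v) (at z)"
proof -
  have "((\<lambda>z. dsl z v) has_derivative
     (\<lambda>w. (of_real (2 * \<gamma> * (z \<bullet> v)) * w + of_real (2 * \<gamma> * (w \<bullet> v)) * z) + of_real (\<gamma> * (z \<bullet> w + w \<bullet> z)) * v)) (at z)"
    unfolding dsl_def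
    by (rule derivative_eq_intros has_derivative_of_real refl)+ simp
  moreover have "(\<lambda>w. (of_real (2 * \<gamma> * (z \<bullet> v)) * w + of_real (2 * \<gamma> * (w \<bullet> v)) * z) + of_real (\<gamma> * (z \<bullet> w + w \<bullet> z)) * v) = d2sl z v"
    by (auto simp: d2sl_def fun_eq_iff inner_commute algebra_simps)
  ultimately show ?thesis by simp
qed

lemma frechet_derivative_F: "frechet_derivative F (at z) = (\<lambda>v. (dsl (fst z) (fst v), dsl (snd z) (snd v)))"
proof (rule frechet_derivative_eqI)
  show "(F has_derivative (\<lambda>v. (dsl (fst z) (fst v), dsl (snd z) (snd v)))) (at z)"
    unfolding F_def[abs_def]
    by (intro has_derivative_Pair has_derivative_compose[OF _ sl_has_derivative]
        has_derivative_fst has_derivative_snd has_derivative_ident)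
qed

lemma F''_eq: "F'' z v w = (d2sl (fst z) (fst v) (fst w), d2sl (snd z) (snd v) (snd w))"
proof -
  have "((\<lambda>x. (dsl (fst x) (fst v), dsl (snd x) (snd v))) has_derivative
      (\<lambda>w. (d2sl (fst z) (fst v) (fst w), d2sl (snd z) (snd v) (snd w)))) (at z)"
    by (intro has_derivative_Pair has_derivative_compose[OF _ dsl_has_derivative]
        has_derivative_fst has_derivative_snd has_derivative_ident)
  from frechet_derivative_eqI[OF this] show ?thesis
    by (simp add: F''_def frechet_derivative_F)
qed

text \<open>Radial perturbations produce a radial second-order term, so this term has no tangential
  part in \<eta>\<open>2\<close>.\<close>

lemma d2sl_radial:
  "d2sl (of_real a * cis t) (of_real r * cis t) (of_real r * cis t) = of_real (6 * \<gamma> * a * r\<^sup>2) * cis t"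
proof -
  have "(of_real a * cis t) \<bullet> (of_real b * cis t) = a * b" for a b
  proof -
    have "a * cos t * (b * cos t) + a * sin t * (b * sin t) = a * b"
      using sin_cos_squared_add2[of t] by algebra
    then show ?thesis by (simp add: inner_complex_def)
  qed
  then show ?thesis
    by (simp add: d2sl_def power2_eq_square algebra_simps)
qed

lemma frechet_derivative_E0:
  "frechet_derivative (\<lambda>\<theta>. E0 \<theta> s) (at \<phi>) u =
    (\<i> * of_real (R * fst u) * cis (fst \<phi> + \<Omega> * s), \<i> * of_real (R * snd u) * cis (snd \<phi> + \<Omega> * s))"
proof -
  have "((\<lambda>\<theta>. E0 \<theta> s) has_derivative (\<lambda>u. (\<i> * of_real (R * fst u) * cis (fst \<phi> + \<Omega> * s),
      \<i> * of_real (R * snd u) * cis (snd \<phi> + \<Omega> * s)))) (at \<phi>)"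
    unfolding E0_def
    by (auto intro!: derivative_eq_intros simp: algebra_simps fun_eq_iff scaleR_conv_of_real)
  from frechet_derivative_eqI[OF this] show ?thesis by simp
qed

end

subsection \<open>First and second order terms\<close>

text \<open>The fundamental theorem for oriented integrals also covers \<open>b < a\<close>, which
  occurs here because the history variable \<open>s\<close> is negative.\<close>

lemma interval_integral_const_vector:
  fixes c :: "'a::euclidean_space"
  shows "(LBINT x=ereal a..ereal b. c) = (b - a) *\<^sub>R c"
  by (subst interval_integral_FTC_finite[where F = "\<lambda>x. x *\<^sub>R c"])
     (auto intro!: derivative_eq_intros simp: scaleR_diff_left has_vector_derivative_def)

context stuart_landau_reduction
begin

text \<open>The effective coupling phase: the coupling rotates by \<rho>, while the delayed signal
  lags by the angle \<open>\<Omega> * \<tau>\<close>.\<close>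

abbreviation \<sigma> :: real where "\<sigma> \<equiv> \<rho> - \<Omega> * \<tau>"

lemma \<eta>1_eq:
  "\<eta>1 \<phi> = (of_real R * cis (fst \<phi>) * (cis (\<sigma> - (fst \<phi> - snd \<phi>)) - cis \<rho>),
     of_real R * cis (snd \<phi>) * (cis (\<sigma> + (fst \<phi> - snd \<phi>)) - cis \<rho>))"
proof -
  have "continuous_on {- \<tau>..0} (E0 \<phi>)"
    unfolding E0_def by (intro continuous_intros)
  from G_segment[OF this] show ?thesis
    using delay_pos
    by (simp add: \<eta>1_def E0_def right_diff_distrib mult.assoc mult.left_commute[of "cis _"] cis_mult add.commute)
       (simp add: algebra_simps)
qed

lemma f1_eq: "f1 = (\<lambda>\<phi>. (sin (\<sigma> - (fst \<phi> - snd \<phi>)) - sin \<rho>, sin (\<sigma> + (fst \<phi> - snd \<phi>)) - sin \<rho>))"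
  and g1_eq: "g1 = (\<lambda>_. 0)"
proof -
  have "(THE s. tangential_solution \<eta>1 s) = (\<lambda>_. 0, \<lambda>\<phi>. (sin (\<sigma> - (fst \<phi> - snd \<phi>)) - sin \<rho>,
      sin (\<sigma> + (fst \<phi> - snd \<phi>)) - sin \<rho>))"
  proof (rule tangential_solution_phase_difference)
    show "Im (cis (- fst \<phi>) * fst (\<eta>1 \<phi>)) = R * (sin (\<sigma> - (fst \<phi> - snd \<phi>)) - sin \<rho>)"
      and "Im (cis (- snd \<phi>) * snd (\<eta>1 \<phi>)) = R * (sin (\<sigma> + (fst \<phi> - snd \<phi>)) - sin \<rho>)" for \<phi>
      unfolding \<eta>1_eq fst_conv snd_conv cis_uminus_mult by simp_all
    show "sin (\<sigma> - (x + 2 * pi)) - sin \<rho> = sin (\<sigma> - x) - sin \<rho>"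
      and "sin (\<sigma> + (x + 2 * pi)) - sin \<rho> = sin (\<sigma> + x) - sin \<rho>" for x
      using sin_periodic[of "\<sigma> - (x + 2 * pi)"] sin_periodic[of "\<sigma> + x"] by (simp_all add: algebra_simps)
    show "((\<lambda>x. sin (\<sigma> - x) - sin \<rho>) has_real_derivative - cos (\<sigma> - x)) (at x)"
      and "((\<lambda>x. sin (\<sigma> + x) - sin \<rho>) has_real_derivative cos (\<sigma> + x)) (at x)" for x
      by (auto intro!: derivative_eq_intros)
  qed (intro continuous_intros)+
  then show "f1 = (\<lambda>\<phi>. (sin (\<sigma> - (fst \<phi> - snd \<phi>)) - sin \<rho>, sin (\<sigma> + (fst \<phi> - snd \<phi>)) - sin \<rho>))"
    and "g1 = (\<lambda>_. 0)"
    by (simp_all add: f1_def g1_def)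
qed

lemma h1_eq: "h1 = (\<lambda>\<phi>. (R / (2 * \<alpha> * \<gamma>) * (cos (\<sigma> - (fst \<phi> - snd \<phi>)) - cos \<rho>),
    R / (2 * \<alpha> * \<gamma>) * (cos (\<sigma> + (fst \<phi> - snd \<phi>)) - cos \<rho>)))"
  unfolding h1_def
proof (rule normal_solution_phase_difference)
  show "Re (cis (- fst \<phi>) * fst (\<eta>1 \<phi>)) =
      2 * \<alpha> * \<gamma> * (R / (2 * \<alpha> * \<gamma>) * (cos (\<sigma> - (fst \<phi> - snd \<phi>)) - cos \<rho>))"
    and "Re (cis (- snd \<phi>) * snd (\<eta>1 \<phi>)) =
      2 * \<alpha> * \<gamma> * (R / (2 * \<alpha> * \<gamma>) * (cos (\<sigma> + (fst \<phi> - snd \<phi>)) - cos \<rho>))" for \<phi>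
    unfolding \<eta>1_eq fst_conv snd_conv cis_uminus_mult by (simp_all add: parameters_nonzero)
  show "R / (2 * \<alpha> * \<gamma>) * (cos (\<sigma> - (x + 2 * pi)) - cos \<rho>) = R / (2 * \<alpha> * \<gamma>) * (cos (\<sigma> - x) - cos \<rho>)"
    and "R / (2 * \<alpha> * \<gamma>) * (cos (\<sigma> + (x + 2 * pi)) - cos \<rho>) = R / (2 * \<alpha> * \<gamma>) * (cos (\<sigma> + x) - cos \<rho>)" for x
    using cos_periodic[of "\<sigma> - (x + 2 * pi)"] cos_periodic[of "\<sigma> + x"] by (simp_all add: algebra_simps)
  show "((\<lambda>x. R / (2 * \<alpha> * \<gamma>) * (cos (\<sigma> - x) - cos \<rho>)) has_real_derivative R / (2 * \<alpha> * \<gamma>) * sin (\<sigma> - x)) (at x)"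
    and "((\<lambda>x. R / (2 * \<alpha> * \<gamma>) * (cos (\<sigma> + x) - cos \<rho>)) has_real_derivative R / (2 * \<alpha> * \<gamma>) * (- sin (\<sigma> + x))) (at x)" for x
    by (rule derivative_eq_intros refl | simp)+
qed (intro continuous_intros)+

text \<open>As \<open>g1 = 0\<close>, the first-order correction is purely radial, which makes
  \<open>d2sl_radial\<close> applicable.\<close>

lemma e1_eq: "e1 = (\<lambda>\<phi>. (of_real (R / (2 * \<alpha>) * (cos (\<sigma> - (fst \<phi> - snd \<phi>)) - cos \<rho>)) * cis (fst \<phi>),
    of_real (R / (2 * \<alpha>) * (cos (\<sigma> + (fst \<phi> - snd \<phi>)) - cos \<rho>)) * cis (snd \<phi>)))"
  by (auto simp: e1_def[abs_def] g1_eq h1_eq T_eq N_def fun_eq_iff parameters_nonzero field_simps)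

lemma frechet_derivative_e1:
  "frechet_derivative e1 (at \<phi>) u =
     (cis (fst \<phi>) * Complex (R / (2 * \<alpha>) * (sin (\<sigma> - (fst \<phi> - snd \<phi>)) * (fst u - snd u)))
          (R / (2 * \<alpha>) * (cos (\<sigma> - (fst \<phi> - snd \<phi>)) - cos \<rho>) * fst u),
      cis (snd \<phi>) * Complex (R / (2 * \<alpha>) * (- sin (\<sigma> + (fst \<phi> - snd \<phi>)) * (fst u - snd u)))
          (R / (2 * \<alpha>) * (cos (\<sigma> + (fst \<phi> - snd \<phi>)) - cos \<rho>) * snd u))"
proof -
  have "((\<lambda>\<phi>. R / (2 * \<alpha>) * (cos (\<sigma> - (fst \<phi> - snd \<phi>)) - cos \<rho>)) has_derivative
      (\<lambda>u. R / (2 * \<alpha>) * (sin (\<sigma> - (fst \<phi> - snd \<phi>)) * (fst u - snd u)))) (at \<phi>)"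
    and "((\<lambda>\<phi>. R / (2 * \<alpha>) * (cos (\<sigma> + (fst \<phi> - snd \<phi>)) - cos \<rho>)) has_derivative
      (\<lambda>u. R / (2 * \<alpha>) * (- sin (\<sigma> + (fst \<phi> - snd \<phi>)) * (fst u - snd u)))) (at \<phi>)"
    by (rule derivative_eq_intros refl | simp add: algebra_simps)+
  from has_derivative_Pair[OF has_derivative_polar[OF this(1) has_derivative_fst[OF has_derivative_ident]]
      has_derivative_polar[OF this(2) has_derivative_snd[OF has_derivative_ident]]]
  show ?thesis
    unfolding e1_eq by (subst frechet_derivative_eqI) simp_all
qed

text \<open>\<open>f1\<close> is constant along \<omega>, so the integral is
  \<open>s *\<^sub>R f1 \<phi>\<close>, and \<open>e1\<close> is merely rotated by
  \<open>\<Omega> * s\<close>. At \<open>s = - \<tau>\<close> the tangential drift, linear in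
  \<open>s\<close>, is the source of the terms of \<open>f2\<close> with the factor \<tau>.\<close>

lemma E1_eq: "E1 \<phi> s =
  (cis (fst \<phi> + \<Omega> * s) * Complex (R / (2 * \<alpha>) * (cos (\<sigma> - (fst \<phi> - snd \<phi>)) - cos \<rho>)) (R * s * fst (f1 \<phi>)),
   cis (snd \<phi> + \<Omega> * s) * Complex (R / (2 * \<alpha>) * (cos (\<sigma> + (fst \<phi> - snd \<phi>)) - cos \<rho>)) (R * s * snd (f1 \<phi>)))"
proof -
  have "f1 (\<phi> + r *\<^sub>R \<omega>) = f1 \<phi>" for r
    by (simp add: f1_eq \<omega>_def)
  then have "(LBINT \<zeta>=0..s. f1 (\<phi> + (s - \<zeta>) *\<^sub>R \<omega>)) = s *\<^sub>R f1 \<phi>"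
    using interval_integral_const_vector[of 0 s "f1 \<phi>"] by (simp add: zero_ereal_def)
  then show ?thesis
    by (simp add: E1_def frechet_derivative_E0 e1_eq \<omega>_def Complex_eq algebra_simps)
qed

lemma G_segment_E1:
  "G (segment (E1 \<phi>)) = (cis \<rho> * (snd (E1 \<phi> (- \<tau>)) - fst (E1 \<phi> 0)), cis \<rho> * (fst (E1 \<phi> (- \<tau>)) - snd (E1 \<phi> 0)))"
proof (rule G_segment)
  show "continuous_on {- \<tau>..0} (E1 \<phi>)"
    unfolding E1_eq[abs_def] Complex_eq by (intro continuous_intros)
qed (use delay_pos in simp)

text \<open>Both components of \<open>f2\<close> are this function, at \<psi> and at
  \<open>- \<psi>\<close>, since exchanging the oscillators reverses the phase difference. The first
  term comes from the radial correction, the second from the delayed tangential drift.\<close>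

definition f2_profile :: "real \<Rightarrow> real" where
  "f2_profile x = 1 / (2 * \<alpha>) * (sin (\<sigma> - x) * (cos (\<sigma> + x) - cos (\<sigma> - x)))
     - \<tau> * (cos (\<sigma> - x) * (sin (\<sigma> + x) - sin \<rho>))"

lemma Im_\<eta>2:
  shows "Im (cis (- fst \<phi>) * fst (\<eta>2 \<phi>)) = R * f2_profile (fst \<phi> - snd \<phi>)" (is ?fst)
    and "Im (cis (- snd \<phi>) * snd (\<eta>2 \<phi>)) = R * f2_profile (- (fst \<phi> - snd \<phi>))" (is ?snd)
proof -
  obtain x y where \<phi>: "\<phi> = (x, y)" by (cases \<phi>)
  define c\<^sub>1 s\<^sub>1 c\<^sub>2 s\<^sub>2 where defs: "c\<^sub>1 = cos (\<sigma> - (x - y))" "s\<^sub>1 = sin (\<sigma> - (x - y))"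
    "c\<^sub>2 = cos (\<sigma> + (x - y))" "s\<^sub>2 = sin (\<sigma> + (x - y))"
  define k where "k = R / (2 * \<alpha>)"
  have F: "Im (cis (- x) * fst (F'' (e0 \<phi>) (e1 \<phi>) (e1 \<phi>))) = 0"
     "Im (cis (- y) * snd (F'' (e0 \<phi>) (e1 \<phi>) (e1 \<phi>))) = 0"
    unfolding F''_eq e0_def e1_eq fst_conv snd_conv d2sl_radial \<phi>
    using cis_uminus_mult[of x _ 1] cis_uminus_mult[of y _ 1] by simp_all
  have e: "Im (cis (- x) * fst (frechet_derivative e1 (at \<phi>) (f1 \<phi>))) = k * (c\<^sub>1 - cos \<rho>) * (s\<^sub>1 - sin \<rho>)"
      "Im (cis (- y) * snd (frechet_derivative e1 (at \<phi>) (f1 \<phi>))) = k * (c\<^sub>2 - cos \<rho>) * (s\<^sub>2 - sin \<rho>)"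
    unfolding frechet_derivative_e1 fst_conv snd_conv \<phi> f1_eq cis_uminus_cancel
    by (simp_all add: defs k_def)
  have E1: "E1 \<phi> 0 = (cis x * of_real (k * (c\<^sub>1 - cos \<rho>)), cis y * of_real (k * (c\<^sub>2 - cos \<rho>)))"
    "E1 \<phi> (- \<tau>) = (cis (x - \<Omega> * \<tau>) * Complex (k * (c\<^sub>1 - cos \<rho>)) (- R * \<tau> * (s\<^sub>1 - sin \<rho>)),
       cis (y - \<Omega> * \<tau>) * Complex (k * (c\<^sub>2 - cos \<rho>)) (- R * \<tau> * (s\<^sub>2 - sin \<rho>)))"
    by (simp_all add: E1_eq f1_eq \<phi> defs k_def Complex_eq)
  \<comment> \<open>Rewrites the coupling in the frame of the receiving oscillator at angle
    \<open>a\<close>, with the partner at angle \<open>b\<close> before the delay.\<close>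
  have cis_shift: "cis (- a) * (cis \<rho> * (cis (b - \<Omega> * \<tau>) * z - cis a * w)) = cis (\<sigma> - (a - b)) * z - cis \<rho> * w"
    for a b z w
  proof -
    have "cis (- a) * (cis \<rho> * (cis (b - \<Omega> * \<tau>) * z - cis a * w)) =
        (cis (- a) * cis \<rho> * cis (b - \<Omega> * \<tau>)) * z - (cis (- a) * cis a) * cis \<rho> * w"
      by (simp only: algebra_simps)
    then show ?thesis by (simp add: cis_mult algebra_simps)
  qed
  have G: "Im (cis (- x) * fst (G (segment (E1 \<phi>)))) =
      s\<^sub>1 * (k * (c\<^sub>2 - cos \<rho>)) - c\<^sub>1 * (R * \<tau> * (s\<^sub>2 - sin \<rho>)) - sin \<rho> * (k * (c\<^sub>1 - cos \<rho>))"
    "Im (cis (- y) * snd (G (segment (E1 \<phi>)))) =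
      s\<^sub>2 * (k * (c\<^sub>1 - cos \<rho>)) - c\<^sub>2 * (R * \<tau> * (s\<^sub>1 - sin \<rho>)) - sin \<rho> * (k * (c\<^sub>2 - cos \<rho>))"
    unfolding G_segment_E1 E1 fst_conv snd_conv cis_shift
    by (simp_all add: defs algebra_simps)
  have "Im (cis (- x) * fst (\<eta>2 \<phi>)) = - (k * (c\<^sub>1 - cos \<rho>) * (s\<^sub>1 - sin \<rho>)) +
      (s\<^sub>1 * (k * (c\<^sub>2 - cos \<rho>)) - c\<^sub>1 * (R * \<tau> * (s\<^sub>2 - sin \<rho>)) - sin \<rho> * (k * (c\<^sub>1 - cos \<rho>)))"
    unfolding \<eta>2_def frechet_derivative_G fst_add fst_diff fst_scaleR distrib_left right_diff_distrib
      mult_scaleR_right plus_complex.sel minus_complex.sel scaleR_complex.sel F e G by simp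
  \<comment> \<open>The products \<open>sin \<rho> * k * (c\<^sub>1 - cos \<rho>)\<close> from
    \<open>e1\<close> and from \<open>G\<close> cancel, as do the terms
    \<open>k * s\<^sub>1 * cos \<rho>\<close>; only
    \<open>k * s\<^sub>1 * (c\<^sub>2 - c\<^sub>1)\<close> and the drift remain.\<close>
  also have "\<dots> = R * f2_profile (x - y)"
  proof -
    have profile: "f2_profile (x - y) = 1 / (2 * \<alpha>) * (s\<^sub>1 * (c\<^sub>2 - c\<^sub>1)) - \<tau> * (c\<^sub>1 * (s\<^sub>2 - sin \<rho>))"
      by (simp add: f2_profile_def defs)
    show ?thesis
      unfolding profile by (simp add: k_def parameters_nonzero field_simps)
  qed
  finally show ?fst by (simp add: \<phi>)
  have "Im (cis (- y) * snd (\<eta>2 \<phi>)) = - (k * (c\<^sub>2 - cos \<rho>) * (s\<^sub>2 - sin \<rho>)) +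
      (s\<^sub>2 * (k * (c\<^sub>1 - cos \<rho>)) - c\<^sub>2 * (R * \<tau> * (s\<^sub>1 - sin \<rho>)) - sin \<rho> * (k * (c\<^sub>2 - cos \<rho>)))"
    unfolding \<eta>2_def frechet_derivative_G snd_add snd_diff snd_scaleR distrib_left right_diff_distrib
      mult_scaleR_right plus_complex.sel minus_complex.sel scaleR_complex.sel F e G by simp
  also have "\<dots> = R * f2_profile (- (x - y))"
  proof -
    have profile: "f2_profile (- (x - y)) = 1 / (2 * \<alpha>) * (s\<^sub>2 * (c\<^sub>1 - c\<^sub>2)) - \<tau> * (c\<^sub>2 * (s\<^sub>1 - sin \<rho>))"
      unfolding defs by (simp only: f2_profile_def diff_minus_eq_add add_uminus_conv_diff)
    show ?thesis
      unfolding profile by (simp add: k_def parameters_nonzero field_simps)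
  qed
  finally show ?snd by (simp add: \<phi>)
qed

lemma f2_eq: "f2 = (\<lambda>\<phi>. (f2_profile (fst \<phi> - snd \<phi>), f2_profile (- (fst \<phi> - snd \<phi>))))"
proof -
  define d where "d = (\<lambda>x. 1 / (2 * \<alpha>) * (sin (\<sigma> - x) * (- sin (\<sigma> + x) - sin (\<sigma> - x)) - cos (\<sigma> - x) * (cos (\<sigma> + x) - cos (\<sigma> - x)))
     - \<tau> * (cos (\<sigma> - x) * cos (\<sigma> + x) + sin (\<sigma> - x) * (sin (\<sigma> + x) - sin \<rho>)))"
  have per: "f2_profile (x + 2 * pi) = f2_profile x" for x
  proof -
    have "\<sigma> - (x + 2 * pi) + 2 * pi = \<sigma> - x" by simp
    then have "sin (\<sigma> - (x + 2 * pi)) = sin (\<sigma> - x)" "cos (\<sigma> - (x + 2 * pi)) = cos (\<sigma> - x)"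
      by (metis sin_periodic, metis cos_periodic)
    moreover have "sin (\<sigma> + (x + 2 * pi)) = sin (\<sigma> + x)" "cos (\<sigma> + (x + 2 * pi)) = cos (\<sigma> + x)"
      by (metis sin_periodic add.assoc, metis cos_periodic add.assoc)
    ultimately show ?thesis by (simp only: f2_profile_def)
  qed
  have der: "(f2_profile has_real_derivative d x) (at x)" for x
    unfolding f2_profile_def[abs_def] d_def
    by (rule derivative_eq_intros refl | simp add: algebra_simps)+
  have "(THE s. tangential_solution \<eta>2 s) =
      (\<lambda>_. 0, \<lambda>\<phi>. (f2_profile (fst \<phi> - snd \<phi>), f2_profile (- (fst \<phi> - snd \<phi>))))"
  proof (rule tangential_solution_phase_difference[where q = "\<lambda>x. f2_profile (- x)"])
    show "Im (cis (- fst \<phi>) * fst (\<eta>2 \<phi>)) = R * f2_profile (fst \<phi> - snd \<phi>)"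
      and "Im (cis (- snd \<phi>) * snd (\<eta>2 \<phi>)) = R * f2_profile (- (fst \<phi> - snd \<phi>))" for \<phi>
      by (rule Im_\<eta>2)+
    show "f2_profile (x + 2 * pi) = f2_profile x" "(f2_profile has_real_derivative d x) (at x)" for x
      by (rule per, rule der)
    show "f2_profile (- (x + 2 * pi)) = f2_profile (- x)" for x
      using per[of "- (x + 2 * pi)"] by simp
    show "((\<lambda>x. f2_profile (- x)) has_real_derivative - d (- x)) (at x)" for x
      using DERIV_chain2[OF der DERIV_minus[OF DERIV_ident]] by simp
    show "continuous_on UNIV d" "continuous_on UNIV (\<lambda>x. - d (- x))"
      unfolding d_def by (intro continuous_intros)+
  qed
  then show ?thesis by (simp add: f2_def)
qed

section \<open>The equation of the phase difference\<close>

lemma f2_profile_odd_part: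
  "f2_profile x - f2_profile (- x) =
    2 * \<tau> * sin \<rho> * sin \<sigma> * sin x - (\<tau> + 1 / \<alpha> * (sin \<sigma>)\<^sup>2) * sin (2 * x)"
proof -
  \<comment> \<open>Produces the term with \<open>1 / \<alpha>\<close>.\<close>
  have 1: "(sin (s - x) + sin (s + x)) * (cos (s + x) - cos (s - x)) = - 2 * (sin s)\<^sup>2 * sin (2 * x)" for s
    unfolding sin_add sin_diff cos_add cos_diff sin_double by (simp add: power2_eq_square)
  \<comment> \<open>Produces the term \<open>\<tau> * sin (2 * x)\<close>.\<close>
  have 2: "cos (\<sigma> - x) * sin (\<sigma> + x) - cos (\<sigma> + x) * sin (\<sigma> - x) = sin (2 * x)"
    using sin_diff[of "\<sigma> + x" "\<sigma> - x"] by (simp add: algebra_simps)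
  \<comment> \<open>Produces the term with \<open>sin \<rho> * sin \<sigma>\<close>.\<close>
  have 3: "cos (s - x) - cos (s + x) = 2 * sin s * sin x" for s
    by (simp add: cos_add cos_diff)
  have "f2_profile x - f2_profile (- x) =
      1 / (2 * \<alpha>) * ((sin (\<sigma> - x) + sin (\<sigma> + x)) * (cos (\<sigma> + x) - cos (\<sigma> - x)))
      - \<tau> * (cos (\<sigma> - x) * sin (\<sigma> + x) - cos (\<sigma> + x) * sin (\<sigma> - x))
      + \<tau> * sin \<rho> * (cos (\<sigma> - x) - cos (\<sigma> + x))"
    by (simp add: f2_profile_def algebra_simps)
  also have "\<dots> = 2 * \<tau> * sin \<rho> * sin \<sigma> * sin x - (\<tau> + 1 / \<alpha> * (sin \<sigma>)\<^sup>2) * sin (2 * x)"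
    unfolding 1 2 3 by (simp add: algebra_simps parameters_nonzero)
  finally show ?thesis .
qed

text \<open>The equal frequencies in \<open>f0\<close> and the common offset
  \<open>- sin \<rho>\<close> in \<open>f1\<close> cancel in the difference.\<close>

lemma reduced_field_phase_difference:
  "fst (reduced_field \<epsilon> \<phi>) - snd (reduced_field \<epsilon> \<phi>) =
    - 2 * \<epsilon> * cos \<sigma> * sin (fst \<phi> - snd \<phi>)
    + \<epsilon>\<^sup>2 * (2 * \<tau> * sin \<rho> * sin \<sigma> * sin (fst \<phi> - snd \<phi>)
      - (\<tau> + 1 / \<alpha> * (sin \<sigma>)\<^sup>2) * sin (2 * (fst \<phi> - snd \<phi>)))"
proof -
  let ?x = "fst \<phi> - snd \<phi>"
  have "fst (reduced_field \<epsilon> \<phi>) - snd (reduced_field \<epsilon> \<phi>) =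
      \<epsilon> * (sin (\<sigma> - ?x) - sin (\<sigma> + ?x)) + \<epsilon>\<^sup>2 * (f2_profile ?x - f2_profile (- ?x))"
    by (simp add: reduced_field_def f0_def f1_eq f2_eq \<omega>_def algebra_simps)
  moreover have "sin (\<sigma> - ?x) - sin (\<sigma> + ?x) = - 2 * cos \<sigma> * sin ?x"
    by (simp only: sin_add sin_diff[of \<sigma>])
  ultimately show ?thesis
    unfolding f2_profile_odd_part by simp
qed

section \<open>The periodic orbit of an uncoupled oscillator\<close>

lemma \<Gamma>_has_vector_derivative: "(\<Gamma> has_vector_derivative sl (\<Gamma> t)) (at t)"
proof -
  have "(cmod (\<Gamma> t))\<^sup>2 = R\<^sup>2"
    by (simp add: \<Gamma>_def norm_mult)
  \<comment> \<open>On the circle of radius \<open>R\<close> the cubic term cancels the growth rate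
    \<alpha> and leaves pure rotation.\<close>
  then have "sl (\<Gamma> t) = Complex \<alpha> \<beta> * \<Gamma> t + of_real (- \<alpha>) * \<Gamma> t"
    by (simp only: sl_def \<gamma>_R)
  also have "\<dots> = \<i> * of_real \<Omega> * \<Gamma> t"
    by (simp add: \<Omega>_def Complex_eq algebra_simps)
  also have "(\<Gamma> has_vector_derivative \<dots>) (at t)"
    unfolding \<Gamma>_def[abs_def] has_vector_derivative_def
    by (auto intro!: derivative_eq_intros simp: scaleR_conv_of_real algebra_simps fun_eq_iff)
  finally show ?thesis .
qed

lemma \<Gamma>_periodic: "\<Omega> \<noteq> 0 \<Longrightarrow> \<Gamma> (t + 2 * pi / \<Omega>) = \<Gamma> t"
  by (simp add: \<Gamma>_def distrib_left flip: cis_mult)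

end

theorem lemma3p2:
  fixes \<alpha> \<beta> \<gamma> \<epsilon> \<rho> \<tau> :: real
  assumes "\<alpha> * \<gamma> < 0" and "\<beta> \<noteq> 0" and "\<epsilon> \<ge> 0" and "\<rho> \<in> {0..2 * pi}" and "\<tau> > 0"
  shows "let \<Omega> = stuart_landau.\<Omega> \<beta>;
      \<Gamma> = stuart_landau.\<Gamma> \<alpha> \<beta> \<gamma>;
      X = stuart_landau.reduced_field \<alpha> \<beta> \<gamma> \<rho> \<tau> \<epsilon>;
      rhs = (\<lambda>\<psi>::real.
        - 2 * \<epsilon> * cos (\<rho> - \<Omega> * \<tau>) * sin \<psi>
        + \<epsilon>\<^sup>2 * (2 * \<tau> * sin \<rho> * sin (\<rho> - \<Omega> * \<tau>) * sin \<psi>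
               - (\<tau> + 1 / \<alpha> * (sin (\<rho> - \<Omega> * \<tau>))\<^sup>2) * sin (2 * \<psi>)))
    in (\<forall>t. (\<Gamma> has_vector_derivative stuart_landau.sl \<alpha> \<beta> \<gamma> (\<Gamma> t)) (at t)) \<and>
       (\<forall>t. \<Gamma> (t + 2 * pi / \<Omega>) = \<Gamma> t) \<and>
       (\<forall>\<phi>. fst (X \<phi>) - snd (X \<phi>) = rhs (fst \<phi> - snd \<phi>)) \<and>
       (\<forall>(I :: real set) \<phi>.
         (\<forall>t\<in>I. (\<phi> has_vector_derivative X (\<phi> t)) (at t within I)) \<longrightarrow>
         (\<forall>t\<in>I. ((\<lambda>t. fst (\<phi> t) - snd (\<phi> t)) has_real_derivative
                   rhs (fst (\<phi> t) - snd (\<phi> t))) (at t within I)))"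
proof -
  interpret stuart_landau_reduction \<alpha> \<beta> \<gamma> \<rho> \<tau>
    using assms by unfold_locales
  show ?thesis
    unfolding Let_def
  proof (intro conjI allI impI ballI)
    fix I :: "real set" and \<phi> t
    assume "\<forall>t\<in>I. (\<phi> has_vector_derivative reduced_field \<epsilon> (\<phi> t)) (at t within I)" and "t \<in> I"
    then have d: "(\<phi> has_vector_derivative reduced_field \<epsilon> (\<phi> t)) (at t within I)" by blast
    \<comment> \<open>Taking coordinates is linear, so along any solution the phase difference moves
      with the difference of the field components, which is known pointwise.\<close>
    have "((\<lambda>t. fst (\<phi> t) - snd (\<phi> t)) has_vector_derivative
        fst (reduced_field \<epsilon> (\<phi> t)) - snd (reduced_field \<epsilon> (\<phi> t))) (at t within I)"
      by (intro has_vector_derivative_diff bounded_linear.has_vector_derivative[OF bounded_linear_fst d]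
          bounded_linear.has_vector_derivative[OF bounded_linear_snd d])
    then show "((\<lambda>t. fst (\<phi> t) - snd (\<phi> t)) has_real_derivative
        - 2 * \<epsilon> * cos \<sigma> * sin (fst (\<phi> t) - snd (\<phi> t))
        + \<epsilon>\<^sup>2 * (2 * \<tau> * sin \<rho> * sin \<sigma> * sin (fst (\<phi> t) - snd (\<phi> t))
          - (\<tau> + 1 / \<alpha> * (sin \<sigma>)\<^sup>2) * sin (2 * (fst (\<phi> t) - snd (\<phi> t))))) (at t within I)"
      unfolding reduced_field_phase_difference has_real_derivative_iff_has_vector_derivative .
  next
    show "\<Gamma> (t + 2 * pi / \<Omega>) = \<Gamma> t" for t
      using assms(2) by (intro \<Gamma>_periodic) (simp add: \<Omega>_def)
  qed (rule \<Gamma>_has_vector_derivative reduced_field_phase_difference)+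
qed

end
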